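(* The false alarm and detection probabilities of the local test ($\Lambda_i\gtrless\tau_i$) and of the centralized test ($\Lambda_c\gtrless\tau_c$) are, respectively, $$P^F_i=Q(\tau_i;p_i,0),\quad P^D_i=Q(\tau_i;p_i,\lambda_i),\qquad P^F_c=Q(\tau_c;p_c,0),\quad P^D_c=Q(\tau_c;p_c,\lambda_c),$$ where $$p_i=\mathrm{Rank}(\Sigma_i),\quad p_c=\mathrm{Rank}(\Sigma_c),\quad \lambda_i=(U^a_i)^{\mathsf T}M_iU^a_i,\quad \lambda_c=(U^a)^{\mathsf T}M_cU^a,$$ $$M_i=(N_i\mathcal F^{(a)}_i)^{\mathsf T}\Sigma_i^{-1}(N_i\mathcal F^{(a)}_i),\qquad M_c=(N_c\mathcal F^{(a)}_c)^{\mathsf T}\Sigma_c^{-1}(N_c\mathcal F^{(a)}_c).$$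
   Context: Interconnected system: for $i\in\{1,\dots,N\}$, $x_i(k+1)=A_{ii}x_i(k)+B_iu_i(k)+B^a_iu^a_i(k)+w_i(k)$, $y_i(k)=C_ix_i(k)+v_i(k)$, where $B_i=[A_{i1}\ \cdots\ A_{i,i-1}\ A_{i,i+1}\ \cdots\ A_{iN}]$ and $u_i=[x_1^{\mathsf T}\ \cdots\ x_{i-1}^{\mathsf T}\ x_{i+1}^{\mathsf T}\ \cdots\ x_N^{\mathsf T}]^{\mathsf T}$. The noises $w_i(k)\sim\mathcal N(0,\Sigma_{w_i})$ and $v_i(k)\sim\mathcal N(0,\Sigma_{v_i})$ are independent over time, of each other, and across subsystems. The initial state and the attack $u^a_i$ are deterministic. Stacking the subsystems: $x(k+1)=Ax(k)+B^au^a(k)+w(k)$, $y(k)=Cx(k)+v(k)$, with $A=[A_{ij}]_{i,j=1}^N$, $B^a=\mathrm{blkdiag}(B^a_1,\dots,B^a_N)$, $C=\mathrm{blkdiag}(C_1,\dots,C_N)$, $\Sigma_w=\mathrm{blkdiag}(\Sigma_{w_1},\dots,\Sigma_{w_N})$, $\Sigma_v=\mathrm{blkdiag}(\Sigma_{v_1},\dots,\Sigma_{v_N})$. Fix a horizon $T>0$. Let $Y_i=[y_i(1)^{\mathsf T}\cdots y_i(T)^{\mathsf T}]^{\mathsf T}$, $Y_c=[y(1)^{\mathsf T}\cdots y(T)^{\mathsf T}]^{\mathsf T}$; $U^a_i=[u^a_i(0)^{\mathsf T}\cdots u^a_i(T-1)^{\mathsf T}]^{\mathsf T}$, $U^a=[u^a(0)^{\mathsf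 T}\cdots u^a(T-1)^{\mathsf T}]^{\mathsf T}$. Define $\mathcal O_i=[(C_iA_{ii})^{\mathsf T}\cdots(C_iA_{ii}^T)^{\mathsf T}]^{\mathsf T}$, and let $\mathcal F^{(a)}_i,\mathcal F^{(u)}_i,\mathcal F^{(w)}_i$ be the $T\times T$ block matrices whose $(j,l)$ block is, for $j\ge l$, $C_iA_{ii}^{j-l}B^a_i$, $C_iA_{ii}^{j-l}B_i$, $C_iA_{ii}^{j-l}$ respectively, and $0$ for $j<l$. Let $\mathcal O_c,\mathcal F^{(a)}_c,\mathcal F^{(w)}_c$ be defined as $\mathcal O_i,\mathcal F^{(a)}_i,\mathcal F^{(w)}_i$ with $A_{ii},B^a_i,C_i$ replaced by $A,B^a,C$. Let the rows of $N_i$ form a basis of the left null space of $[\mathcal O_i\ \ \mathcal F^{(u)}_i]$ and the rows of $N_c$ a basis of the left null space of $\mathcal O_c$ (these null spaces are nontrivial). Set $\widetilde Y_i=N_iY_i$, $\widetilde Y_c=N_cY_c$, with means $\beta_i=N_i\mathcal F^{(a)}_iU^a_i$, $\beta_c=N_c\mathcal F^{(a)}_cU^a$ and covariances $\Sigma_i=N_i[\mathcal F^{(w)}_i(I_T\otimes\Sigma_{w_i})(\mathcal F^{(w)}_i)^{\mathsf T}+(I_T\otimes\Sigma_{v_i})]N_i^{\mathsf T}$, $\Sigma_c=N_c[\mathcal F^{(w)}_c(I_T\otimes\Sigma_w)(\mathcal F^{(w)}_c)^{\mathsf T}+(I_T\otimes\Sigma_v)]N_c^{\mathsf T}$, assumed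 invertible. Tests: with thresholds $\tau_i,\tau_c\ge0$, the $i$-th local detector decides $H_1$ if $\Lambda_i:=\widetilde Y_i^{\mathsf T}\Sigma_i^{-1}\widetilde Y_i\ge\tau_i$ and $H_0$ otherwise; the centralized detector decides $H_1$ if $\Lambda_c:=\widetilde Y_c^{\mathsf T}\Sigma_c^{-1}\widetilde Y_c\ge\tau_c$ and $H_0$ otherwise. Hypothesis $H_0$: no attack, the mean ($\beta_i$, resp. $\beta_c$) is zero. Hypothesis $H_1$: the system is under the (fixed, deterministic) attack $U^a$ and the mean is nonzero. The probabilities are $P^F_i=\Pr[\Lambda_i\ge\tau_i\mid H_0]$, $P^D_i=\Pr[\Lambda_i\ge\tau_i\mid H_1]$, $P^F_c=\Pr[\Lambda_c\ge\tau_c\mid H_0]$, $P^D_c=\Pr[\Lambda_c\ge\tau_c\mid H_1]$. $Q(\tau;p,\lambda)$ denotes the complementary cumulative distribution function at $\tau\ge0$ of the noncentral chi-squared distribution $\chi^2(p,\lambda)$ with $p$ degrees of freedom and noncentrality parameter $\lambda$. *)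

theory Defs
  imports
    "HOL-Probability.Probability"
    "Jordan_Normal_Form.Matrix_Kernel"
    "Jordan_Normal_Form.DL_Rank"
    "Jordan_Normal_Form.Gauss_Jordan_Elimination"
begin

no_notation inner (infix \<open>\<bullet>\<close> 70)
no_notation vec_nth (infixl \<open>$\<close> 90)

section \<open>Gaussian vectors and the noncentral chi-squared distribution\<close>

text \<open>The space of \<open>n\<close>-vectors with the Borel sigma-algebra of its coordinates.\<close>

definition vec_borel :: "nat \<Rightarrow> real vec measure" where
  "vec_borel n = vimage_algebra (carrier_vec n) (\<lambda>x. \<lambda>j\<in>{..<n}. x $ j) (\<Pi>\<^sub>M j\<in>{..<n}. borel)"

definition std_gaussian :: "nat \<Rightarrow> (nat \<Rightarrow> real) measure" where
  "std_gaussian n = (\<Pi>\<^sub>M j\<in>{..<n}. density lborel (\<lambda>x. ennreal (std_normal_density x)))"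

text \<open>\<open>X \<sim> \<N>(\<mu>, \<Sigma>)\<close>: the law of \<open>X\<close> is that of \<open>\<mu> + L Z\<close>, where \<open>Z\<close> is a vector of independent
  standard normal variables and \<open>\<Sigma> = L L\<^sup>T\<close>. Singular \<open>\<Sigma>\<close> is allowed.\<close>

definition gaussian_vec ::
    "'w measure \<Rightarrow> nat \<Rightarrow> ('w \<Rightarrow> real vec) \<Rightarrow> real vec \<Rightarrow> real mat \<Rightarrow> bool" where
  "gaussian_vec M n X \<mu> \<Sigma> \<longleftrightarrow>
     X \<in> measurable M (vec_borel n) \<and> \<mu> \<in> carrier_vec n \<and>
     (\<exists>k L. L \<in> carrier_mat n k \<and> \<Sigma> = L * L\<^sup>T \<and>
        distr M (vec_borel n) X =
        distr (std_gaussian k) (vec_borel n) (\<lambda>z. \<mu> + L *\<^sub>v vec k z))"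

text \<open>The law of the sum of squares of \<open>p\<close> independent unit-variance normal variables whose squared
  means sum up to \<open>l\<close>. Only this sum matters for the law, so the mean vector is taken to be
  \<open>(\<surd>l, 0, \<dots>, 0)\<close>.\<close>

definition noncentral_chi_squared :: "nat \<Rightarrow> real \<Rightarrow> real measure" where
  "noncentral_chi_squared p l =
     distr (std_gaussian p) borel (\<lambda>z. \<Sum>j<p. (z j + (if j = 0 then sqrt l else 0))\<^sup>2)"

definition Q :: "real \<Rightarrow> nat \<Rightarrow> real \<Rightarrow> real" where
  "Q \<tau> p l = 1 - cdf (noncentral_chi_squared p l) \<tau>"

section \<open>Block vectors and matrices\<close>

definition stack_vecs :: "real vec list \<Rightarrow> real vec" where
  "stack_vecs xs = vec_of_list (concat (map list_of_vec xs))"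

text \<open>Blocks on top of each other (all with \<open>nc\<close> columns), resp. side by side (all with \<open>nr\<close> rows).\<close>

definition stack_rows :: "nat \<Rightarrow> real mat list \<Rightarrow> real mat" where
  "stack_rows nc Ms = mat_of_rows nc (concat (map rows Ms))"

definition stack_cols :: "nat \<Rightarrow> real mat list \<Rightarrow> real mat" where
  "stack_cols nr Ms = mat_of_cols nr (concat (map cols Ms))"

definition block_mat ::
    "(nat \<Rightarrow> nat) \<Rightarrow> (nat \<Rightarrow> nat) \<Rightarrow> nat list \<Rightarrow> nat list \<Rightarrow> (nat \<Rightarrow> nat \<Rightarrow> real mat) \<Rightarrow> real mat" where
  "block_mat nr nc I J F =
     stack_rows (\<Sum>j\<leftarrow>J. nc j) (map (\<lambda>i. stack_cols (nr i) (map (F i) J)) I)"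

definition lower_toeplitz :: "nat \<Rightarrow> nat \<Rightarrow> nat \<Rightarrow> (nat \<Rightarrow> real mat) \<Rightarrow> real mat" where
  "lower_toeplitz T p q F =
     block_mat (\<lambda>_. p) (\<lambda>_. q) [1..<T+1] [1..<T+1]
       (\<lambda>j l. if l \<le> j then F (j - l) else 0\<^sub>m p q)"

definition kronecker :: "real mat \<Rightarrow> real mat \<Rightarrow> real mat" where
  "kronecker A B = mat (dim_row A * dim_row B) (dim_col A * dim_col B)
     (\<lambda>(i, j). A $$ (i div dim_row B, j div dim_col B) * B $$ (i mod dim_row B, j mod dim_col B))"

definition inv_mat :: "real mat \<Rightarrow> real mat" where
  "inv_mat A = the (mat_inverse A)"

definition mat_rank :: "real mat \<Rightarrow> nat" where
  "mat_rank A = vec_space.rank (dim_row A) A"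

definition left_null_space :: "real mat \<Rightarrow> real vec set" where
  "left_null_space G = mat_kernel (G\<^sup>T)"

definition rows_basis_left_null :: "real mat \<Rightarrow> real mat \<Rightarrow> bool" where
  "rows_basis_left_null K G \<longleftrightarrow>
     dim_col K = dim_row G \<and> distinct (rows K) \<and>
     vectorspace.basis class_ring
       ((module_vec TYPE(real) (dim_row G))\<lparr>carrier := left_null_space G\<rparr>) (set (rows K))"

section \<open>The interconnected system\<close>

text \<open>Subsystems are numbered \<open>1, \<dots>, nsub\<close>.\<close>

record interconnected_system =
  nsub :: nat
  sdim :: "nat \<Rightarrow> nat"                \<comment> \<open>dimension of \<open>x\<^sub>i\<close>\<close>
  adim :: "nat \<Rightarrow> nat"                \<comment> \<open>dimension of \<open>u\<^sup>a\<^sub>i\<close>\<close>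
  odim :: "nat \<Rightarrow> nat"                \<comment> \<open>dimension of \<open>y\<^sub>i\<close>\<close>
  Amat :: "nat \<Rightarrow> nat \<Rightarrow> real mat"
  Bamat :: "nat \<Rightarrow> real mat"
  Cmat :: "nat \<Rightarrow> real mat"
  covw :: "nat \<Rightarrow> real mat"
  covv :: "nat \<Rightarrow> real mat"
  init :: "nat \<Rightarrow> real vec"

abbreviation subsystems :: "interconnected_system \<Rightarrow> nat list" where
  "subsystems S \<equiv> [1..<nsub S + 1]"

abbreviation others :: "interconnected_system \<Rightarrow> nat \<Rightarrow> nat list" where
  "others S i \<equiv> filter (\<lambda>j. j \<noteq> i) (subsystems S)"

definition well_formed :: "interconnected_system \<Rightarrow> bool" where
  "well_formed S \<longleftrightarrow> 0 < nsub S \<and> (\<forall>i\<in>{1..nsub S}.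
     (\<forall>j\<in>{1..nsub S}. Amat S i j \<in> carrier_mat (sdim S i) (sdim S j)) \<and>
     Bamat S i \<in> carrier_mat (sdim S i) (adim S i) \<and>
     Cmat S i \<in> carrier_mat (odim S i) (sdim S i) \<and>
     covw S i \<in> carrier_mat (sdim S i) (sdim S i) \<and>
     covv S i \<in> carrier_mat (odim S i) (odim S i) \<and>
     init S i \<in> carrier_vec (sdim S i))"

text \<open>Signals are functions of the subsystem and of time.\<close>

type_synonym signal = "nat \<Rightarrow> nat \<Rightarrow> real vec"

definition admissible_attack :: "interconnected_system \<Rightarrow> signal \<Rightarrow> bool" where
  "admissible_attack S a \<longleftrightarrow> (\<forall>i\<in>{1..nsub S}. \<forall>k. a i k \<in> carrier_vec (adim S i))"

definition no_attack :: "interconnected_system \<Rightarrow> signal" where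
  "no_attack S = (\<lambda>i k. 0\<^sub>v (adim S i))"

definition gaussian_noise :: "'w measure \<Rightarrow> interconnected_system \<Rightarrow>
    (nat \<Rightarrow> nat \<Rightarrow> 'w \<Rightarrow> real vec) \<Rightarrow> (nat \<Rightarrow> nat \<Rightarrow> 'w \<Rightarrow> real vec) \<Rightarrow> bool" where
  "gaussian_noise M S w v \<longleftrightarrow>
     (\<forall>i\<in>{1..nsub S}. \<forall>k.
        gaussian_vec M (sdim S i) (w i k) (0\<^sub>v (sdim S i)) (covw S i) \<and>
        gaussian_vec M (odim S i) (v i k) (0\<^sub>v (odim S i)) (covv S i)) \<and>
     prob_space.indep_vars M
       (case_sum (\<lambda>(i, k). vec_borel (sdim S i)) (\<lambda>(i, k). vec_borel (odim S i)))
       (case_sum (\<lambda>(i, k). w i k) (\<lambda>(i, k). v i k))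
       (({1..nsub S} \<times> UNIV) <+> ({1..nsub S} \<times> UNIV))"

definition coupling_mat :: "interconnected_system \<Rightarrow> nat \<Rightarrow> real mat" where
  "coupling_mat S i = stack_cols (sdim S i) (map (Amat S i) (others S i))"

text \<open>\<open>state S a w k i\<close> and \<open>meas S a w v k i\<close> are \<open>x\<^sub>i(k)\<close> and \<open>y\<^sub>i(k)\<close> for the attack \<open>a\<close> and the noise
  realizations \<open>w\<close>, \<open>v\<close>.\<close>

primrec state :: "interconnected_system \<Rightarrow> signal \<Rightarrow> signal \<Rightarrow> nat \<Rightarrow> nat \<Rightarrow> real vec" where
  "state S a w 0 = init S"
| "state S a w (Suc k) = (\<lambda>i.
     Amat S i i *\<^sub>v state S a w k i
     + coupling_mat S i *\<^sub>v stack_vecs (map (state S a w k) (others S i))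
     + Bamat S i *\<^sub>v a i k + w i k)"

definition meas :: "interconnected_system \<Rightarrow> signal \<Rightarrow> signal \<Rightarrow> signal \<Rightarrow> nat \<Rightarrow> nat \<Rightarrow> real vec" where
  "meas S a w v k i = Cmat S i *\<^sub>v state S a w k i + v i k"

definition local_meas ::
    "interconnected_system \<Rightarrow> nat \<Rightarrow> nat \<Rightarrow> signal \<Rightarrow> signal \<Rightarrow> signal \<Rightarrow> real vec" where
  "local_meas S T i a w v = stack_vecs (map (\<lambda>k. meas S a w v k i) [1..<T+1])"

definition central_meas ::
    "interconnected_system \<Rightarrow> nat \<Rightarrow> signal \<Rightarrow> signal \<Rightarrow> signal \<Rightarrow> real vec" where
  "central_meas S T a w v =
     stack_vecs (map (\<lambda>k. stack_vecs (map (meas S a w v k) (subsystems S))) [1..<T+1])"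

definition local_attack :: "nat \<Rightarrow> nat \<Rightarrow> signal \<Rightarrow> real vec" where
  "local_attack T i a = stack_vecs (map (a i) [0..<T])"

definition central_attack :: "interconnected_system \<Rightarrow> nat \<Rightarrow> signal \<Rightarrow> real vec" where
  "central_attack S T a =
     stack_vecs (map (\<lambda>k. stack_vecs (map (\<lambda>i. a i k) (subsystems S))) [0..<T])"

section \<open>Detectors\<close>

text \<open>The data \<open>(A, B\<^sup>a, C, \<Sigma>\<^sub>w, \<Sigma>\<^sub>v)\<close> a detector works with: those of one subsystem for a local
  detector, those of the stacked system for the centralized one.\<close>

record detector_model =
  dynm :: "real mat"
  attm :: "real mat"
  outm :: "real mat"
  pcov :: "real mat"
  mcov :: "real mat"

definition local_model :: "interconnected_system \<Rightarrow> nat \<Rightarrow> detector_model" where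
  "local_model S i = \<lparr>dynm = Amat S i i, attm = Bamat S i, outm = Cmat S i,
     pcov = covw S i, mcov = covv S i\<rparr>"

definition central_model :: "interconnected_system \<Rightarrow> detector_model" where
  "central_model S =
     \<lparr>dynm = block_mat (sdim S) (sdim S) (subsystems S) (subsystems S) (Amat S),
      attm = diag_block_mat (map (Bamat S) (subsystems S)),
      outm = diag_block_mat (map (Cmat S) (subsystems S)),
      pcov = diag_block_mat (map (covw S) (subsystems S)),
      mcov = diag_block_mat (map (covv S) (subsystems S))\<rparr>"

definition obs_mat :: "nat \<Rightarrow> detector_model \<Rightarrow> real mat" where
  "obs_mat T D = stack_rows (dim_col (dynm D)) (map (\<lambda>j. outm D * dynm D ^\<^sub>m j) [1..<T+1])"

text \<open>The response to an input entering through \<open>B\<close>; this is \<open>\<F>\<^sup>(\<^sup>a\<^sup>)\<close> for \<open>B = B\<^sup>a\<close>, and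
  \<open>\<F>\<^sup>(\<^sup>u\<^sup>)\<close> when \<open>B\<close> is the coupling matrix.\<close>

definition input_response :: "nat \<Rightarrow> detector_model \<Rightarrow> real mat \<Rightarrow> real mat" where
  "input_response T D B = lower_toeplitz T (dim_row (outm D)) (dim_col B)
     (\<lambda>d. outm D * dynm D ^\<^sub>m d * B)"

definition noise_response :: "nat \<Rightarrow> detector_model \<Rightarrow> real mat" where
  "noise_response T D = lower_toeplitz T (dim_row (outm D)) (dim_col (dynm D))
     (\<lambda>d. outm D * dynm D ^\<^sub>m d)"

abbreviation attack_response :: "nat \<Rightarrow> detector_model \<Rightarrow> real mat" where
  "attack_response T D \<equiv> input_response T D (attm D)"

definition local_nuisance :: "interconnected_system \<Rightarrow> nat \<Rightarrow> nat \<Rightarrow> real mat" where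
  "local_nuisance S T i = stack_cols (T * odim S i)
     [obs_mat T (local_model S i), input_response T (local_model S i) (coupling_mat S i)]"

definition central_nuisance :: "interconnected_system \<Rightarrow> nat \<Rightarrow> real mat" where
  "central_nuisance S T = obs_mat T (central_model S)"

text \<open>In the following, \<open>K\<close> is the matrix \<open>N\<^sub>i\<close> resp. \<open>N\<^sub>c\<close>.\<close>

definition test_cov :: "nat \<Rightarrow> detector_model \<Rightarrow> real mat \<Rightarrow> real mat" where
  "test_cov T D K =
     K * (noise_response T D * kronecker (1\<^sub>m T) (pcov D) * (noise_response T D)\<^sup>T
          + kronecker (1\<^sub>m T) (mcov D)) * K\<^sup>T"

definition test_mean :: "nat \<Rightarrow> detector_model \<Rightarrow> real mat \<Rightarrow> real vec \<Rightarrow> real vec" where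
  "test_mean T D K U = (K * attack_response T D) *\<^sub>v U"

definition test_statistic :: "nat \<Rightarrow> detector_model \<Rightarrow> real mat \<Rightarrow> real vec \<Rightarrow> real" where
  "test_statistic T D K Y = (K *\<^sub>v Y) \<bullet> (inv_mat (test_cov T D K) *\<^sub>v (K *\<^sub>v Y))"

definition dof :: "nat \<Rightarrow> detector_model \<Rightarrow> real mat \<Rightarrow> nat" where
  "dof T D K = mat_rank (test_cov T D K)"

definition sensitivity_mat :: "nat \<Rightarrow> detector_model \<Rightarrow> real mat \<Rightarrow> real mat" where
  "sensitivity_mat T D K =
     (K * attack_response T D)\<^sup>T * inv_mat (test_cov T D K) * (K * attack_response T D)"

definition noncentrality :: "nat \<Rightarrow> detector_model \<Rightarrow> real mat \<Rightarrow> real vec \<Rightarrow> real" where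
  "noncentrality T D K U = U \<bullet> (sensitivity_mat T D K *\<^sub>v U)"

text \<open>Probability that a detector with threshold \<open>\<tau>\<close> decides \<open>H\<^sub>1\<close> when the system is under the
  attack \<open>a\<close>.\<close>

definition local_alarm_prob :: "'w measure \<Rightarrow> interconnected_system \<Rightarrow>
    (nat \<Rightarrow> nat \<Rightarrow> 'w \<Rightarrow> real vec) \<Rightarrow> (nat \<Rightarrow> nat \<Rightarrow> 'w \<Rightarrow> real vec) \<Rightarrow>
    nat \<Rightarrow> nat \<Rightarrow> real mat \<Rightarrow> real \<Rightarrow> signal \<Rightarrow> real" where
  "local_alarm_prob M S w v T i K \<tau> a =
     \<P>(\<omega> in M. test_statistic T (local_model S i) K
        (local_meas S T i a (\<lambda>j k. w j k \<omega>) (\<lambda>j k. v j k \<omega>)) \<ge> \<tau>)"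

definition central_alarm_prob :: "'w measure \<Rightarrow> interconnected_system \<Rightarrow>
    (nat \<Rightarrow> nat \<Rightarrow> 'w \<Rightarrow> real vec) \<Rightarrow> (nat \<Rightarrow> nat \<Rightarrow> 'w \<Rightarrow> real vec) \<Rightarrow>
    nat \<Rightarrow> real mat \<Rightarrow> real \<Rightarrow> signal \<Rightarrow> real" where
  "central_alarm_prob M S w v T K \<tau> a =
     \<P>(\<omega> in M. test_statistic T (central_model S) K
        (central_meas S T a (\<lambda>j k. w j k \<omega>) (\<lambda>j k. v j k \<omega>)) \<ge> \<tau>)"

end

theory Submission
  imports Defs
begin

text \<open>
  By linearity, the measurements over the horizon are a nuisance term plus the response to the attack
  plus the response to the noise. The rows of the projection matrix span the left null space of the
  nuisance matrix, so the projected measurement is the deterministic vector \<open>\<beta>\<close> plus a linear image of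
  the noise (\<open>local_meas_residual\<close>, \<open>central_meas_residual\<close>). The noise vectors are independent and
  Gaussian, hence the projected measurement has the characteristic function of a Gaussian vector with
  mean \<open>\<beta>\<close> and covariance \<open>\<Sigma>\<close> (\<open>stacked_noise_char\<close>, \<open>alarm_prob\<close>). With a square
  factorization \<open>\<Sigma> = G G\<^sup>T\<close> the test statistic becomes the squared norm of a vector with mean of squared
  norm \<open>\<lambda>\<close> and identity covariance (\<open>whitening_mat\<close>, \<open>prob_quadratic_form_ge\<close>).

  That this squared norm has the noncentral chi-squared law is usually derived from the uniqueness of
  multivariate Gaussian laws and their rotation invariance. Here a shorter path is taken. Averaging
  \<open>exp (i \<surd>(2 s) \<eta> \<bullet> W)\<close> over a standard Gaussian \<open>\<eta>\<close> gives \<open>exp (- s \<bar>W\<bar>\<^sup>2)\<close>; exchanging this average with the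
  expectation over \<open>W\<close> expresses the Laplace transform of \<open>\<bar>W\<bar>\<^sup>2\<close> by the characteristic function of
  \<open>W\<close>, and the outcome depends on the mean of \<open>W\<close> only through its norm (\<open>laplace_sum_squares\<close>). The
  Laplace transform at the natural numbers lists the moments of \<open>exp (- \<bar>W\<bar>\<^sup>2)\<close>, a bounded variable,
  whose law they determine (\<open>distr_eq_if_moments_eq\<close>).

  The left null spaces are nontrivial, so there is at least one degree of freedom and the chi-squared law
  has no atoms. Therefore it makes no difference that the test alarms when the statistic equals the threshold
  (\<open>prob_sum_squares_ge\<close>).
\<close>

section \<open>Sums of squares of independent normal variables\<close>

lemma product_prob_space_std_normal: "product_prob_space (\<lambda>_::nat. std_normal_distribution)"
  by (intro product_prob_spaceI) (simp add: prob_space_normal_density)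

lemma prob_space_std_gaussian: "prob_space (std_gaussian k)"
  unfolding std_gaussian_def by (intro prob_space_PiM) (simp add: prob_space_normal_density)

lemma measurable_std_gaussian_component:
  "j < k \<Longrightarrow> (\<lambda>z. z j) \<in> borel_measurable (std_gaussian k)"
  unfolding std_gaussian_def using measurable_component_singleton[of j "{..<k}" "\<lambda>_. std_normal_distribution"]
  by simp

lemma integral_std_gaussian_prod:
  fixes f :: "nat \<Rightarrow> real \<Rightarrow> complex"
  assumes "\<And>j. j < k \<Longrightarrow> integrable std_normal_distribution (f j)"
  shows "(\<integral>z. (\<Prod>j<k. f j (z j)) \<partial>std_gaussian k) = (\<Prod>j<k. \<integral>x. f j x \<partial>std_normal_distribution)"
proof -
  interpret product_prob_space "\<lambda>_::nat. std_normal_distribution"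
    by (rule product_prob_space_std_normal)
  show ?thesis
    unfolding std_gaussian_def using assms by (subst product_integral_prod) auto
qed

lemma integrable_normal_bounded:
  fixes f :: "real \<Rightarrow> complex"
  assumes "f \<in> borel_measurable borel" "\<And>x. cmod (f x) \<le> 1"
  shows "integrable std_normal_distribution f"
proof -
  interpret prob_space std_normal_distribution by (simp add: prob_space_normal_density)
  show ?thesis using assms by (intro integrable_const_bound[where B = 1]) auto
qed

lemma exp_i_sum:
  "iexp (\<Sum>j\<in>I. x j) = (\<Prod>j\<in>I. iexp (x j))" if "finite I"
  using that by (simp only: of_real_sum sum_distrib_left exp_sum)

text \<open>Read from right to left, this writes a Gaussian function of \<open>c\<close> as an average of characters, which is
  what makes the averaging argument below possible.\<close>

lemma char_std_gaussian:
  "(\<integral>z. iexp (\<Sum>j<k. c j * z j) \<partial>std_gaussian k)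
     = complex_of_real (exp (- (\<Sum>j<k. (c j)\<^sup>2) / 2))"
proof -
  have "(\<integral>z. iexp (\<Sum>j<k. c j * z j) \<partial>std_gaussian k)
      = (\<integral>z. (\<Prod>j<k. iexp (c j * z j)) \<partial>std_gaussian k)"
    by (subst exp_i_sum) auto
  also have "\<dots> = (\<Prod>j<k. \<integral>x. iexp (c j * x) \<partial>std_normal_distribution)"
    by (rule integral_std_gaussian_prod[where f = "\<lambda>j x. iexp (c j * x)"])
       (auto intro!: integrable_normal_bounded)
  also have "\<dots> = (\<Prod>j<k. complex_of_real (exp (- ((c j)\<^sup>2) / 2)))"
    using fun_cong[OF char_std_normal_distribution] unfolding char_def by (intro prod.cong refl)
  also have "\<dots> = complex_of_real (exp (- (\<Sum>j<k. (c j)\<^sup>2) / 2))"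
    by (simp add: exp_sum sum_negf[symmetric] sum_divide_distrib flip: of_real_prod)
  finally show ?thesis .
qed

text \<open>The weight \<open>exp (- s x\<^sup>2)\<close> turns the standard normal density into a multiple of the density of
  variance \<open>1 / (1 + 2 s)\<close>, so after rescaling this is the characteristic function of a normal law.\<close>

lemma integral_normal_twisted:
  fixes s t :: real
  assumes "0 \<le> s"
  shows "(\<integral>x. iexp (t * x) * complex_of_real (exp (- s * x\<^sup>2)) \<partial>std_normal_distribution)
       = complex_of_real (1 / sqrt (1 + 2 * s) * exp (- (t\<^sup>2 / (2 * (1 + 2 * s)))))"
proof -
  define q where "q = sqrt (1 + 2 * s)"
  have q: "q > 0" "q\<^sup>2 = 1 + 2 * s" using assms by (auto simp: q_def)
  have dens: "std_normal_density x * exp (- s * x\<^sup>2) = std_normal_density (q * x)" for x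
    unfolding std_normal_density_def
    by (simp add: power_mult_distrib q exp_add[symmetric] field_simps)
  let ?g = "\<lambda>y. std_normal_density y *\<^sub>R iexp (t / q * y)"
  have "(\<integral>x. iexp (t * x) * complex_of_real (exp (- s * x\<^sup>2)) \<partial>std_normal_distribution)
      = (\<integral>x. std_normal_density x *\<^sub>R (iexp (t * x) * complex_of_real (exp (- s * x\<^sup>2))) \<partial>lborel)"
    by (subst integral_density) auto
  also have "\<dots> = (\<integral>x. ?g (0 + q * x) \<partial>lborel)"
  proof (intro Bochner_Integration.integral_cong refl)
    fix x
    have "std_normal_density x *\<^sub>R (iexp (t * x) * complex_of_real (exp (- s * x\<^sup>2)))
        = complex_of_real (std_normal_density x * exp (- s * x\<^sup>2)) * iexp (t * x)"
      by (simp add: scaleR_conv_of_real mult_ac)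
    also have "\<dots> = ?g (0 + q * x)"
      using q by (subst dens) (simp add: scaleR_conv_of_real)
    finally show "std_normal_density x *\<^sub>R (iexp (t * x) * complex_of_real (exp (- s * x\<^sup>2)))
        = ?g (0 + q * x)" .
  qed
  also have "\<dots> = (1 / q) *\<^sub>R (\<integral>y. ?g y \<partial>lborel)"
    using q by (subst lborel_integral_real_affine[where c = q and t = 0]) auto
  also have "(\<integral>y. ?g y \<partial>lborel) = char std_normal_distribution (t / q)"
    unfolding char_def by (subst integral_density) (auto simp: mult_ac)
  also have "\<dots> = complex_of_real (exp (- (t\<^sup>2 / (2 * (1 + 2 * s)))))"
    by (simp add: char_std_normal_distribution power_divide q mult_ac)
  finally show ?thesis using q by (simp add: scaleR_conv_of_real q_def)
qed

text \<open>The Laplace transform of \<open>\<Sum>\<^sub>j (W j)\<^sup>2\<close> can be computed from the characteristic function of the vector \<open>W\<close>,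
  without identifying the joint law of \<open>W\<close>: replace \<open>exp (- s x\<^sup>2)\<close> by the average of
  \<open>exp (i \<surd>(2 s) z x)\<close> over a standard normal \<open>z\<close> and exchange the two integrations. The inner
  integral is then the given characteristic function, and the outer one splits into a product over
  the coordinates. The result sees the mean \<open>m\<close> only through its squared norm, which is why the
  noncentral chi-squared law has a single noncentrality parameter.\<close>

lemma (in prob_space) laplace_sum_squares:
  fixes W :: "'a \<Rightarrow> nat \<Rightarrow> real" and m :: "nat \<Rightarrow> real"
  assumes meas: "\<And>j. j < p \<Longrightarrow> (\<lambda>\<omega>. W \<omega> j) \<in> borel_measurable M"
    and ch: "\<And>\<eta>::nat \<Rightarrow> real. (\<integral>\<omega>. iexp (\<Sum>j<p. \<eta> j * W \<omega> j) \<partial>M)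
        = iexp (\<Sum>j<p. \<eta> j * m j) * complex_of_real (exp (- (\<Sum>j<p. (\<eta> j)\<^sup>2) / 2))"
    and s: "0 \<le> s"
  shows "(\<integral>\<omega>. exp (- s * (\<Sum>j<p. (W \<omega> j)\<^sup>2)) \<partial>M)
       = (1 / sqrt (1 + 2 * s)) ^ p * exp (- (s / (1 + 2 * s)) * (\<Sum>j<p. (m j)\<^sup>2))"
proof -
  interpret G: prob_space "std_gaussian p" by (rule prob_space_std_gaussian)
  interpret P: pair_prob_space M "std_gaussian p" ..
  note [measurable] = meas measurable_std_gaussian_component[of _ p]
  define r where "r = sqrt (2 * s)"
  have r: "r\<^sup>2 = 2 * s" using s by (simp add: r_def)
  have "complex_of_real (\<integral>\<omega>. exp (- s * (\<Sum>j<p. (W \<omega> j)\<^sup>2)) \<partial>M)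
      = (\<integral>\<omega>. complex_of_real (exp (- s * (\<Sum>j<p. (W \<omega> j)\<^sup>2))) \<partial>M)"
    by simp
  also have "\<dots> = (\<integral>\<omega>. (\<integral>z. iexp (\<Sum>j<p. (r * W \<omega> j) * z j) \<partial>std_gaussian p) \<partial>M)"
    by (subst char_std_gaussian) (simp add: power_mult_distrib r mult.assoc flip: sum_distrib_left)
  also have "\<dots> = (\<integral>z. (\<integral>\<omega>. iexp (\<Sum>j<p. (r * W \<omega> j) * z j) \<partial>M) \<partial>std_gaussian p)"
    by (rule P.Fubini_integral[symmetric])
       (auto intro!: P.integrable_const_bound[where B = 1] simp: case_prod_beta)
  also have "\<dots> = (\<integral>z. (\<Prod>j<p. iexp ((r * m j) * z j) * complex_of_real (exp (- s * (z j)\<^sup>2)))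
      \<partial>std_gaussian p)"
  proof (intro Bochner_Integration.integral_cong refl)
    fix z
    have "(\<integral>\<omega>. iexp (\<Sum>j<p. (r * W \<omega> j) * z j) \<partial>M)
        = (\<integral>\<omega>. iexp (\<Sum>j<p. (r * z j) * W \<omega> j) \<partial>M)"
      by (simp add: mult_ac)
    also have "\<dots> = iexp (\<Sum>j<p. (r * m j) * z j)
        * complex_of_real (exp (\<Sum>j<p. - s * (z j)\<^sup>2))"
      by (subst ch) (simp add: power_mult_distrib r sum_distrib_left[symmetric] sum_negf mult_ac)
    also have "\<dots> = (\<Prod>j<p. iexp ((r * m j) * z j) * complex_of_real (exp (- s * (z j)\<^sup>2)))"
      by (subst exp_i_sum) (simp_all add: exp_sum prod.distrib)
    finally show "(\<integral>\<omega>. iexp (\<Sum>j<p. (r * W \<omega> j) * z j) \<partial>M)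
        = (\<Prod>j<p. iexp ((r * m j) * z j) * complex_of_real (exp (- s * (z j)\<^sup>2)))" .
  qed
  also have "\<dots> = (\<Prod>j<p. \<integral>x. iexp ((r * m j) * x) * complex_of_real (exp (- s * x\<^sup>2))
      \<partial>std_normal_distribution)"
    using s by (intro integral_std_gaussian_prod integrable_normal_bounded) (auto simp: norm_mult)
  also have "\<dots> = (\<Prod>j<p. complex_of_real (1 / sqrt (1 + 2 * s) * exp (- (s / (1 + 2 * s)) * (m j)\<^sup>2)))"
  proof (intro prod.cong refl)
    fix j
    have "(r * m j)\<^sup>2 / (2 * (1 + 2 * s)) = s / (1 + 2 * s) * (m j)\<^sup>2"
      using s by (simp add: power_mult_distrib r field_simps)
    then show "(\<integral>x. iexp ((r * m j) * x) * complex_of_real (exp (- s * x\<^sup>2)) \<partial>std_normal_distribution)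
        = complex_of_real (1 / sqrt (1 + 2 * s) * exp (- (s / (1 + 2 * s)) * (m j)\<^sup>2))"
      using integral_normal_twisted[OF s, of "r * m j"] by simp
  qed
  also have "\<dots> = complex_of_real ((1 / sqrt (1 + 2 * s)) ^ p * exp (- (s / (1 + 2 * s)) * (\<Sum>j<p. (m j)\<^sup>2)))"
    by (simp only: of_real_prod[symmetric] prod.distrib sum_distrib_left exp_sum[OF finite_lessThan])
       simp
  finally show ?thesis by (simp only: of_real_eq_iff)
qed

text \<open>A bounded variable has a characteristic function that is the sum of its moment series, so its law is
  determined by its moments. This is applied to \<open>exp (- X)\<close> with \<open>X\<close> nonnegative, whose moments are values of the Laplace
  transform of \<open>X\<close>.\<close>

lemma char_bounded_moments:
  fixes Z :: "'c \<Rightarrow> real"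
  assumes K: "prob_space K" and Z: "Z \<in> borel_measurable K" "\<And>\<omega>. \<bar>Z \<omega>\<bar> \<le> 1"
  shows "char (distr K borel Z) t
    = (\<Sum>n. ((\<i> * complex_of_real t) ^ n / fact n) * complex_of_real (\<integral>\<omega>. Z \<omega> ^ n \<partial>K))"
proof -
  interpret K: prob_space K by fact
  note [measurable] = Z(1)
  let ?f = "\<lambda>n \<omega>. ((\<i> * complex_of_real t) ^ n / fact n) * complex_of_real (Z \<omega> ^ n)"
  have bnd: "norm (?f n \<omega>) \<le> \<bar>t\<bar> ^ n / fact n" for n \<omega>
    using Z(2)[of \<omega>] by (simp add: norm_mult norm_divide norm_power power_le_one mult_left_le divide_right_mono)
  have sm: "summable (\<lambda>n. \<bar>t\<bar> ^ n / fact n)"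
    using summable_exp[of "\<bar>t\<bar>"] by (simp add: divide_inverse mult.commute)
  have int: "integrable K (?f n)" for n
    using bnd[of n] by (intro K.integrable_const_bound[where B = "\<bar>t\<bar> ^ n / fact n"]) (auto simp del: norm_mult)
  have "char (distr K borel Z) t = (\<integral>\<omega>. exp (\<i> * complex_of_real t * complex_of_real (Z \<omega>)) \<partial>K)"
    unfolding char_def by (subst integral_distr) (auto simp: mult_ac)
  also have "\<dots> = (\<integral>\<omega>. (\<Sum>n. ?f n \<omega>) \<partial>K)"
    by (simp add: exp_def power_mult_distrib scaleR_conv_of_real divide_inverse mult_ac)
  also have "\<dots> = (\<Sum>n. \<integral>\<omega>. ?f n \<omega> \<partial>K)"
  proof (rule integral_suminf[OF int])
    show "AE x in K. summable (\<lambda>i. norm (?f i x))"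
      by (intro AE_I2 summable_comparison_test'[OF sm, of 0]) (use bnd in auto)
    have "norm (\<integral>x. norm (?f i x) \<partial>K) \<le> \<bar>t\<bar> ^ i / fact i" for i
    proof -
      have "(\<integral>x. norm (?f i x) \<partial>K) \<le> (\<integral>x. \<bar>t\<bar> ^ i / fact i \<partial>K)"
        by (intro integral_mono integrable_norm int bnd) auto
      then show ?thesis by (simp add: K.prob_space)
    qed
    then show "summable (\<lambda>i. \<integral>x. norm (?f i x) \<partial>K)"
      by (intro summable_comparison_test'[OF sm, of 0])
  qed
  also have "\<dots> = (\<Sum>n. ((\<i> * complex_of_real t) ^ n / fact n) * complex_of_real (\<integral>\<omega>. Z \<omega> ^ n \<partial>K))"
    by (simp del: of_real_power)
  finally show ?thesis .
qed

lemma distr_eq_if_moments_eq: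
  fixes X :: "'a \<Rightarrow> real" and Y :: "'b \<Rightarrow> real"
  assumes "prob_space M" "prob_space N"
    and X: "X \<in> borel_measurable M" "\<And>\<omega>. \<bar>X \<omega>\<bar> \<le> 1"
    and Y: "Y \<in> borel_measurable N" "\<And>\<omega>. \<bar>Y \<omega>\<bar> \<le> 1"
    and mom: "\<And>n::nat. (\<integral>\<omega>. X \<omega> ^ n \<partial>M) = (\<integral>\<omega>. Y \<omega> ^ n \<partial>N)"
  shows "distr M borel X = distr N borel Y"
proof -
  show ?thesis
  proof (rule Levy_uniqueness)
    show "char (distr M borel X) = char (distr N borel Y)"
      using assms by (simp add: fun_eq_iff char_bounded_moments)
  qed (use assms in \<open>auto intro!: prob_space.real_distribution_distr\<close>)
qed

lemma emeasure_std_normal_singleton: "emeasure std_normal_distribution {c} = 0"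
  by (subst emeasure_density) (auto simp: nn_integral_indicator_singleton intro!: nn_integral_0_iff_AE[THEN iffD2] AE_I[where N = "{c}"])

text \<open>With all coordinates but one fixed, at most two values of the remaining one solve the equation. For
  \<open>p = 0\<close> the sum is constant, and its value is an atom.\<close>

lemma sum_squares_atomless:
  assumes "0 < p"
  shows "emeasure (std_gaussian p) {z \<in> space (std_gaussian p). (\<Sum>j<p. (z j + c j)\<^sup>2) = \<tau>} = 0"
proof -
  interpret product_prob_space "\<lambda>_::nat. std_normal_distribution"
    by (rule product_prob_space_std_normal)
  note [measurable] = measurable_std_gaussian_component[of _ p]
  obtain q where p: "p = Suc q" using assms by (cases p) auto
  let ?N = "std_normal_distribution"
  define A where "A = {z \<in> space (std_gaussian p). (\<Sum>j<p. (z j + c j)\<^sup>2) = \<tau>}"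
  have A: "A \<in> sets (std_gaussian p)" unfolding A_def by measurable
  have PI: "std_gaussian p = PiM (insert q {..<q}) (\<lambda>_. ?N)"
    by (simp add: std_gaussian_def p lessThan_Suc)
  have "emeasure (std_gaussian p) A = (\<integral>\<^sup>+z. indicator A z \<partial>PiM (insert q {..<q}) (\<lambda>_. ?N))"
    using A by (simp add: PI)
  also have "\<dots> = (\<integral>\<^sup>+z. (\<integral>\<^sup>+y. indicator A (z(q := y)) \<partial>?N) \<partial>PiM {..<q} (\<lambda>_. ?N))"
    using A by (intro product_nn_integral_insert) (auto simp: PI)
  also have "\<dots> = (\<integral>\<^sup>+z. 0 \<partial>PiM {..<q} (\<lambda>_. ?N))"
  proof (intro nn_integral_cong)
    fix z
    define r where "r = \<tau> - (\<Sum>j<q. (z j + c j)\<^sup>2)"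
    \<comment> \<open>If \<open>r\<close> is negative the equation has no solution, and \<open>?B\<close> is merely too large.\<close>
    let ?B = "{sqrt r - c q, - sqrt r - c q}"
    have "indicator A (z(q := y)) \<le> (indicator ?B y :: ennreal)" for y
    proof (cases "z(q := y) \<in> A")
      case True
      have "(y + c q)\<^sup>2 = r"
        using True by (simp add: A_def p r_def)
      then have "\<bar>y + c q\<bar> = sqrt r" by (metis real_sqrt_abs)
      then have "y \<in> ?B" by auto
      then show ?thesis by (simp split: split_indicator)
    qed simp
    then have "(\<integral>\<^sup>+y. indicator A (z(q := y)) \<partial>?N) \<le> (\<integral>\<^sup>+y. indicator ?B y \<partial>?N)"
      by (intro nn_integral_mono)
    also have "\<dots> = emeasure ?N ?B" by simp
    also have "\<dots> \<le> emeasure ?N {sqrt r - c q} + emeasure ?N {- sqrt r - c q}"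
      using emeasure_subadditive[of "{sqrt r - c q}" ?N "{- sqrt r - c q}"] by (simp add: insert_commute)
    finally show "(\<integral>\<^sup>+y. indicator A (z(q := y)) \<partial>?N) = 0"
      by (simp add: emeasure_std_normal_singleton)
  qed
  finally show ?thesis by (simp add: A_def)
qed

text \<open>Both \<open>W\<close> and the reference vector \<open>z + d\<close> that defines the noncentral chi-squared law fall under
  the Laplace transform computed above, with means of equal norm. The absence of atoms reconciles the
  test, which alarms for \<open>\<ge> \<tau>\<close>, with the complementary distribution function, which is the probability of \<open>> \<tau>\<close>.\<close>

lemma (in prob_space) prob_sum_squares_ge:
  fixes W :: "'a \<Rightarrow> nat \<Rightarrow> real" and m :: "nat \<Rightarrow> real"
  assumes p: "0 < p"
    and meas: "\<And>j. j < p \<Longrightarrow> (\<lambda>\<omega>. W \<omega> j) \<in> borel_measurable M"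
    and ch: "\<And>\<eta>::nat \<Rightarrow> real. (\<integral>\<omega>. iexp (\<Sum>j<p. \<eta> j * W \<omega> j) \<partial>M)
        = iexp (\<Sum>j<p. \<eta> j * m j) * complex_of_real (exp (- (\<Sum>j<p. (\<eta> j)\<^sup>2) / 2))"
  shows "prob {\<omega> \<in> space M. \<tau> \<le> (\<Sum>j<p. (W \<omega> j)\<^sup>2)} = Q \<tau> p (\<Sum>j<p. (m j)\<^sup>2)"
proof -
  interpret G: prob_space "std_gaussian p" by (rule prob_space_std_gaussian)
  note [measurable] = meas measurable_std_gaussian_component[of _ p]
  define l where "l = (\<Sum>j<p. (m j)\<^sup>2)"
  define d where "d j = (if j = 0 then sqrt l else 0)" for j :: nat
  have l: "0 \<le> l" unfolding l_def by (intro sum_nonneg) auto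
  have d: "(\<Sum>j<p. (d j)\<^sup>2) = l"
  proof -
    have "(\<Sum>j<p. (d j)\<^sup>2) = (\<Sum>j<p. if j = 0 then l else 0)"
      using l by (intro sum.cong) (auto simp: d_def)
    then show ?thesis using p by simp
  qed
  let ?S = "\<lambda>\<omega>. \<Sum>j<p. (W \<omega> j)\<^sup>2" and ?R = "\<lambda>z. \<Sum>j<p. (z j + d j)\<^sup>2"
  have ref: "(\<integral>z. iexp (\<Sum>j<p. \<eta> j * (z j + d j)) \<partial>std_gaussian p)
      = iexp (\<Sum>j<p. \<eta> j * d j) * complex_of_real (exp (- (\<Sum>j<p. (\<eta> j)\<^sup>2) / 2))" for \<eta>
  proof -
    have "(\<integral>z. iexp (\<Sum>j<p. \<eta> j * (z j + d j)) \<partial>std_gaussian p)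
        = (\<integral>z. iexp (\<Sum>j<p. \<eta> j * d j) * iexp (\<Sum>j<p. \<eta> j * z j) \<partial>std_gaussian p)"
      by (simp only: distrib_left sum.distrib of_real_add exp_add mult.commute)
    then show ?thesis by (simp only: integral_mult_right_zero char_std_gaussian)
  qed
  have "distr M borel (\<lambda>\<omega>. exp (- ?S \<omega>)) = distr (std_gaussian p) borel (\<lambda>z. exp (- ?R z))"
  proof (rule distr_eq_if_moments_eq)
    fix n :: nat
    have "(\<integral>\<omega>. exp (- ?S \<omega>) ^ n \<partial>M) = (\<integral>\<omega>. exp (- real n * ?S \<omega>) \<partial>M)"
      by (simp add: exp_of_nat_mult[symmetric])
    also have "\<dots> = (1 / sqrt (1 + 2 * real n)) ^ p * exp (- (real n / (1 + 2 * real n)) * l)"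
      unfolding l_def by (rule laplace_sum_squares[OF meas ch]) auto
    also have "\<dots> = (\<integral>z. exp (- real n * ?R z) \<partial>std_gaussian p)"
      unfolding d[symmetric] by (rule G.laplace_sum_squares[OF _ ref, symmetric]) auto
    also have "\<dots> = (\<integral>z. exp (- ?R z) ^ n \<partial>std_gaussian p)"
      by (simp add: exp_of_nat_mult[symmetric])
    finally show "(\<integral>\<omega>. exp (- ?S \<omega>) ^ n \<partial>M) = (\<integral>z. exp (- ?R z) ^ n \<partial>std_gaussian p)" .
  qed (auto intro!: prob_space_axioms G.prob_space_axioms sum_nonneg)
  then have "measure (distr M borel (\<lambda>\<omega>. exp (- ?S \<omega>))) {..exp (- \<tau>)}
      = measure (distr (std_gaussian p) borel (\<lambda>z. exp (- ?R z))) {..exp (- \<tau>)}"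
    by simp
  then have "prob {\<omega> \<in> space M. \<tau> \<le> ?S \<omega>} = G.prob {z \<in> space (std_gaussian p). \<tau> \<le> ?R z}"
    by (simp add: measure_distr vimage_def Int_def conj_commute)
  also have "\<dots> = G.prob {z \<in> space (std_gaussian p). \<tau> < ?R z}"
  proof -
    have "AE z in std_gaussian p. ?R z \<noteq> \<tau>"
      using sum_squares_atomless[OF p, of d \<tau>] by (intro AE_I'[of "{z \<in> space (std_gaussian p). ?R z = \<tau>}"]) (auto simp: null_sets_def)
    then show ?thesis by (intro G.finite_measure_eq_AE) auto
  qed
  also have "\<dots> = 1 - G.prob {z \<in> space (std_gaussian p). ?R z \<le> \<tau>}"
    by (subst G.prob_compl[symmetric]) (auto intro!: arg_cong[where f = G.prob])
  also have "\<dots> = Q \<tau> p l"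
    unfolding Q_def cdf_def noncentral_chi_squared_def d_def
    by (subst measure_distr) (auto simp: vimage_def Int_def conj_commute)
  finally show ?thesis by (simp add: l_def)
qed

section \<open>Quadratic forms in Gaussian vectors\<close>

lemma measurable_vec_borel_component: "i < n \<Longrightarrow> (\<lambda>x. x $ i) \<in> borel_measurable (vec_borel n)"
proof -
  assume i: "i < n"
  have "(\<lambda>x. \<lambda>j\<in>{..<n}. x $ j) \<in> measurable (vec_borel n) (\<Pi>\<^sub>M j\<in>{..<n}. (borel :: real measure))"
    unfolding vec_borel_def by (rule measurable_vimage_algebra1) (auto simp: space_PiM)
  from measurable_compose[OF this measurable_component_singleton[of i]]
  show ?thesis using i by simp
qed

lemma space_vec_borel [simp]: "space (vec_borel n) = carrier_vec n"
  by (simp add: vec_borel_def)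

lemma measurable_vec_borelI:
  assumes "\<And>x. x \<in> space M \<Longrightarrow> f x \<in> carrier_vec n"
    and "\<And>i. i < n \<Longrightarrow> (\<lambda>x. f x $ i) \<in> borel_measurable M"
  shows "f \<in> measurable M (vec_borel n)"
  unfolding vec_borel_def using assms by (intro measurable_vimage_algebra2 measurable_restrict) auto

lemma scalar_prod_sum: "v \<in> carrier_vec n \<Longrightarrow> u \<bullet> v = (\<Sum>i<n. u $ i * v $ i)"
  by (auto simp: scalar_prod_def lessThan_atLeast0)

lemma measurable_scalar_prod:
  "(\<lambda>x. a \<bullet> x) \<in> borel_measurable (vec_borel n)"
proof (subst measurable_cong)
  show "a \<bullet> x = (\<Sum>i<n. a $ i * x $ i)" if "x \<in> space (vec_borel n)" for x
    using that by (simp add: scalar_prod_sum)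
qed (intro borel_measurable_sum borel_measurable_times borel_measurable_const measurable_vec_borel_component, simp)

lemma gaussian_vec_cov:
  assumes "gaussian_vec M n X \<mu> \<Sigma>"
  shows "\<Sigma> \<in> carrier_mat n n" "\<Sigma>\<^sup>T = \<Sigma>"
  using assms unfolding gaussian_vec_def by (auto simp: transpose_mult)

lemma gaussian_vec_char:
  assumes G: "gaussian_vec M n X (0\<^sub>v n) \<Sigma>" and a: "a \<in> carrier_vec n"
  shows "(\<integral>\<omega>. iexp (a \<bullet> X \<omega>) \<partial>M) = complex_of_real (exp (- (a \<bullet> (\<Sigma> *\<^sub>v a)) / 2))"
proof -
  from G obtain k L where X: "X \<in> measurable M (vec_borel n)"
    and L: "L \<in> carrier_mat n k" and S: "\<Sigma> = L * L\<^sup>T"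
    and D: "distr M (vec_borel n) X = distr (std_gaussian k) (vec_borel n) (\<lambda>z. 0\<^sub>v n + L *\<^sub>v vec k z)"
    unfolding gaussian_vec_def by auto
  note [measurable] = measurable_scalar_prod[of a n] X measurable_std_gaussian_component[of _ k]
  let ?c = "L\<^sup>T *\<^sub>v a"
  have c: "?c \<in> carrier_vec k" using L a by auto
  have lin: "a \<bullet> (0\<^sub>v n + L *\<^sub>v vec k z) = (\<Sum>j<k. ?c $ j * z j)" for z
  proof -
    have "a \<bullet> (0\<^sub>v n + L *\<^sub>v vec k z) = a \<bullet> (L *\<^sub>v vec k z)" using L by simp
    also have "\<dots> = ?c \<bullet> vec k z" using transpose_vec_mult_scalar[OF L _ a, of "vec k z"] by simp
    also have "\<dots> = (\<Sum>j<k. ?c $ j * z j)" by (subst scalar_prod_sum[of _ k]) auto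
    finally show ?thesis .
  qed
  have mz [measurable]: "(\<lambda>z. 0\<^sub>v n + L *\<^sub>v vec k z) \<in> measurable (std_gaussian k) (vec_borel n)"
  proof (rule measurable_vec_borelI)
    fix i assume i: "i < n"
    have "(0\<^sub>v n + L *\<^sub>v vec k z) $ i = (\<Sum>j<k. L $$ (i, j) * z j)" for z
      using L i by (simp add: scalar_prod_def lessThan_atLeast0)
    then show "(\<lambda>z. (0\<^sub>v n + L *\<^sub>v vec k z) $ i) \<in> borel_measurable (std_gaussian k)" by simp
  qed (use L in simp)
  have "(\<integral>\<omega>. iexp (a \<bullet> X \<omega>) \<partial>M) = (\<integral>x. iexp (a \<bullet> x) \<partial>distr M (vec_borel n) X)"
    by (subst integral_distr) auto
  also have "\<dots> = (\<integral>z. iexp (a \<bullet> (0\<^sub>v n + L *\<^sub>v vec k z)) \<partial>std_gaussian k)"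
    unfolding D by (subst integral_distr) auto
  also have "\<dots> = complex_of_real (exp (- (\<Sum>j<k. (?c $ j)\<^sup>2) / 2))"
    unfolding lin by (rule char_std_gaussian)
  also have "(\<Sum>j<k. (?c $ j)\<^sup>2) = ?c \<bullet> ?c"
    using scalar_prod_sum[OF c, of ?c] by (simp add: power2_eq_square)
  also have "\<dots> = a \<bullet> (L *\<^sub>v ?c)" by (rule transpose_vec_mult_scalar[OF L c a])
  also have "\<dots> = a \<bullet> (\<Sigma> *\<^sub>v a)" using L a by (simp add: S)
  finally show ?thesis .
qed

text \<open>Cholesky factorization by induction on the size: the last row and column are split off, and the
  quadratic form of the Schur complement is the value of the original form at the minimizing last
  coordinate. Since \<open>x / 0 = 0\<close>, the same formulas cover a vanishing pivot \<open>a\<close>; positivity then forces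
  the rest of its row to vanish.\<close>

lemma psd_gram_fun:
  fixes A :: "nat \<Rightarrow> nat \<Rightarrow> real"
  assumes "\<And>i j. i < n \<Longrightarrow> j < n \<Longrightarrow> A i j = A j i"
    and "\<And>x. 0 \<le> (\<Sum>i<n. \<Sum>j<n. x i * A i j * x j)"
  shows "\<exists>G. \<forall>i<n. \<forall>j<n. A i j = (\<Sum>k<n. G i k * G j k)"
  using assms
proof (induction n arbitrary: A)
  case (Suc n)
  define a where "a = A n n"
  define b where "b i = A i n" for i
  have sym: "A n i = b i" if "i < n" for i using Suc.prems(1)[of n i] that by (simp add: b_def)
  have expand: "(\<Sum>i<Suc n. \<Sum>j<Suc n. x i * A i j * x j)
      = (\<Sum>i<n. \<Sum>j<n. x i * A i j * x j) + 2 * x n * (\<Sum>i<n. x i * b i) + (x n)\<^sup>2 * a" for x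
    by (simp add: sum.distrib sym sum_distrib_left a_def power2_eq_square flip: b_def) (simp add: mult_ac sum_distrib_left)
  have pos: "0 \<le> (\<Sum>i<n. \<Sum>j<n. x i * A i j * x j) + 2 * t * (\<Sum>i<n. x i * b i) + t\<^sup>2 * a" for x t
    using Suc.prems(2)[of "x(n := t)"] unfolding expand by simp
  have a: "0 \<le> a" using pos[of "\<lambda>_. 0" 1] by simp
  have b0: "b i = 0" if "a = 0" "i < n" for i
  proof (rule ccontr)
    assume bi: "b i \<noteq> 0"
    let ?x = "\<lambda>j. if j = i then 1 else 0 :: real"
    have "(\<Sum>k<n. \<Sum>j<n. ?x k * A k j * ?x j) = A i i" "(\<Sum>k<n. ?x k * b k) = b i"
      using that(2) by (simp_all add: if_distrib[where f = "\<lambda>z. z * _"] if_distrib[where f = "\<lambda>z. _ * z"] cong: if_cong)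
    then have "0 \<le> A i i + 2 * (- (A i i + 1) / (2 * b i)) * b i"
      using pos[of ?x "- (A i i + 1) / (2 * b i)"] \<open>a = 0\<close> by simp
    then show False using bi by (simp add: field_simps)
  qed
  let ?A = "\<lambda>i j. A i j - b i * b j / a"
  have "\<exists>G. \<forall>i<n. \<forall>j<n. ?A i j = (\<Sum>k<n. G i k * G j k)"
  proof (rule Suc.IH)
    fix x
    define s where "s = (\<Sum>i<n. x i * b i)"
    have "(\<Sum>i<n. \<Sum>j<n. x i * (b i * b j / a) * x j) = s\<^sup>2 / a"
      by (simp add: s_def power2_eq_square sum_product sum_divide_distrib mult_ac)
    then have "(\<Sum>i<n. \<Sum>j<n. x i * ?A i j * x j) = (\<Sum>i<n. \<Sum>j<n. x i * A i j * x j) - s\<^sup>2 / a"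
      by (simp add: algebra_simps sum_subtractf)
    also have "\<dots> = (\<Sum>i<n. \<Sum>j<n. x i * A i j * x j) + 2 * (- s / a) * s + (- s / a)\<^sup>2 * a"
      by (cases "a = 0") (simp_all add: field_simps power2_eq_square)
    also have "\<dots> \<ge> 0" using pos[of x "- s / a"] by (simp add: s_def)
    finally show "0 \<le> (\<Sum>i<n. \<Sum>j<n. x i * ?A i j * x j)" .
  qed (use Suc.prems(1) in \<open>simp add: mult.commute\<close>)
  then obtain G where G: "\<And>i j. i < n \<Longrightarrow> j < n \<Longrightarrow> ?A i j = (\<Sum>k<n. G i k * G j k)" by blast
  define H where "H i k = (if k < n then if i < n then G i k else 0 else if i < n then b i / sqrt a else sqrt a)" for i k
  have Hs: "(\<Sum>k<Suc n. H i k * H j k) = (\<Sum>k<n. H i k * H j k) + H i n * H j n" for i j by simp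
  have "A i j = (\<Sum>k<Suc n. H i k * H j k)" if "i < Suc n" "j < Suc n" for i j
  proof -
    consider "i < n" "j < n" | "i < n" "j = n" | "i = n" "j < n" | "i = n" "j = n"
      using \<open>i < Suc n\<close> \<open>j < Suc n\<close> by linarith
    then show ?thesis
    proof cases
      case 1
      then show ?thesis using G[of i j] a unfolding Hs by (simp add: H_def)
    next
      case 2
      then show ?thesis using b0[of i] a unfolding Hs by (cases "a = 0") (simp_all add: H_def b_def)
    next
      case 3
      then show ?thesis using b0[of j] a sym[of j] unfolding Hs by (cases "a = 0") (simp_all add: H_def)
    next
      case 4
      then show ?thesis using a unfolding Hs by (simp add: H_def flip: a_def)
    qed
  qed
  then show ?case by blast
qed simp

lemma quadratic_form_sum:
  "A \<in> carrier_mat n n \<Longrightarrow> x \<in> carrier_vec n \<Longrightarrow> x \<bullet> (A *\<^sub>v x) = (\<Sum>i<n. \<Sum>j<n. x $ i * A $$ (i, j) * x $ j)"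
  for x :: "real vec"
  by (simp add: scalar_prod_def lessThan_atLeast0 sum_distrib_left mult_ac)

lemma psd_gram:
  fixes A :: "real mat"
  assumes A: "A \<in> carrier_mat n n" "A\<^sup>T = A" and psd: "\<And>x. x \<in> carrier_vec n \<Longrightarrow> 0 \<le> x \<bullet> (A *\<^sub>v x)"
  obtains G where "G \<in> carrier_mat n n" "A = G * G\<^sup>T"
proof -
  have "\<exists>G. \<forall>i<n. \<forall>j<n. A $$ (i, j) = (\<Sum>k<n. G i k * G j k)"
  proof (rule psd_gram_fun)
    show "A $$ (i, j) = A $$ (j, i)" if "i < n" "j < n" for i j
      using A that by (metis carrier_matD index_transpose_mat(1))
    fix x :: "nat \<Rightarrow> real"
    show "0 \<le> (\<Sum>i<n. \<Sum>j<n. x i * A $$ (i, j) * x j)"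
      using psd[of "vec n x"] quadratic_form_sum[OF A(1), of "vec n x"] by simp
  qed
  then obtain G where G: "\<forall>i<n. \<forall>j<n. A $$ (i, j) = (\<Sum>k<n. G i k * G j k)" by blast
  have "A = mat n n (\<lambda>(i, j). G i j) * (mat n n (\<lambda>(i, j). G i j))\<^sup>T"
    using A(1) G by (intro eq_matI) (auto simp: scalar_prod_def lessThan_atLeast0)
  then show ?thesis by (intro that[of "mat n n (\<lambda>(i, j). G i j)"]) auto
qed

lemma inv_mat_works:
  assumes A: "A \<in> carrier_mat n n" and inv: "invertible_mat A"
  shows "inv_mat A \<in> carrier_mat n n" "A * inv_mat A = 1\<^sub>m n" "inv_mat A * A = 1\<^sub>m n"
proof -
  obtain B where B: "A * B = 1\<^sub>m n" "B * A = 1\<^sub>m (dim_row B)"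
    using inv A unfolding invertible_mat_def inverts_mat_def by auto
  have "dim_col B = n" using arg_cong[OF B(1), of dim_col] by simp
  moreover have "dim_row B = n" using arg_cong[OF B(2), of dim_col] A by simp
  ultimately have "B \<in> carrier_mat n n" by auto
  then have "A \<in> Units (ring_mat TYPE(real) n ())"
    using A B unfolding Units_def by (auto simp: ring_mat_simps)
  then obtain C where "mat_inverse A = Some C"
    using mat_inverse(1)[OF A, of "()"] by (cases "mat_inverse A") auto
  then show "inv_mat A \<in> carrier_mat n n" "A * inv_mat A = 1\<^sub>m n" "inv_mat A * A = 1\<^sub>m n"
    using mat_inverse(2)[OF A] by (auto simp: inv_mat_def)
qed

text \<open>For \<open>A = G G\<^sup>T\<close> with a square factor, the inverse \<open>H\<close> of \<open>G\<close> does the job; it is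
  expressed as \<open>G\<^sup>T\<close> times the inverse of \<open>A\<close>. A square \<open>G\<close> matters: a factor \<open>A = L L\<^sup>T\<close> with more columns than rows, as in
  the definition of Gaussian vectors, would not give the right number of degrees of freedom.\<close>

lemma whitening_mat:
  assumes A: "A \<in> carrier_mat n n" "A\<^sup>T = A" and psd: "\<And>x. x \<in> carrier_vec n \<Longrightarrow> 0 \<le> x \<bullet> (A *\<^sub>v x)"
    and inv: "invertible_mat A"
  obtains H where "H \<in> carrier_mat n n" "inv_mat A = H\<^sup>T * H" "H * (A * H\<^sup>T) = 1\<^sub>m n"
proof -
  obtain G where G: "G \<in> carrier_mat n n" "A = G * G\<^sup>T" using psd_gram[OF A psd] by blast
  let ?B = "inv_mat A"
  note B = inv_mat_works[OF A(1) inv]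
  have BtA: "?B\<^sup>T * A = 1\<^sub>m n" using transpose_mult[OF A(1) B(1)] unfolding B(2) A(2) by simp
  have sym: "?B\<^sup>T = ?B"
  proof -
    have "?B\<^sup>T = ?B\<^sup>T * (A * ?B)" unfolding B(2) using B(1) by simp
    also have "\<dots> = (?B\<^sup>T * A) * ?B" by (rule assoc_mult_mat[symmetric]) (use A B in auto)
    also have "\<dots> = ?B" unfolding BtA using B(1) by simp
    finally show ?thesis .
  qed
  define H where "H = G\<^sup>T * ?B"
  have H: "H \<in> carrier_mat n n" "H\<^sup>T = ?B * G" 
    using G(1) B(1) transpose_mult[of "G\<^sup>T" n n ?B n] by (simp_all add: H_def sym)
  have GH: "G * H = 1\<^sub>m n"
    unfolding H_def B(2)[symmetric] by (subst (2) G(2), rule assoc_mult_mat[symmetric]) (use G B in auto)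
  have "H\<^sup>T * H = ?B * (G * H)"
    unfolding H(2) by (rule assoc_mult_mat) (use G H B in auto)
  then have 1: "?B = H\<^sup>T * H" using B(1) GH by simp
  from GH have "H * G = 1\<^sub>m n" using mat_mult_left_right_inverse[OF G(1) H(1)] by simp
  moreover have "A * H\<^sup>T = G"
  proof -
    have "A * H\<^sup>T = (A * ?B) * G"
      unfolding H(2) by (rule assoc_mult_mat[symmetric]) (use A B G in auto)
    then show ?thesis unfolding B(2) using G(1) by simp
  qed
  ultimately show ?thesis using that[OF H(1) 1] by simp
qed

text \<open>Whitening by \<open>H\<close> turns the quadratic form into a sum of squares and the covariance into the
  identity. Positive semidefiniteness of \<open>\<Sigma>\<close> comes for free, because a characteristic function is
  bounded by 1.\<close>

lemma (in prob_space) prob_quadratic_form_ge: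
  fixes Y :: "'a \<Rightarrow> real vec"
  assumes p: "0 < p"
    and Y: "Y \<in> measurable M (vec_borel p)" and \<mu>: "\<mu> \<in> carrier_vec p"
    and \<Sigma>: "\<Sigma> \<in> carrier_mat p p" "\<Sigma>\<^sup>T = \<Sigma>" "invertible_mat \<Sigma>"
    and ch: "\<And>\<xi>. \<xi> \<in> carrier_vec p \<Longrightarrow>
      (\<integral>\<omega>. iexp (\<xi> \<bullet> Y \<omega>) \<partial>M) = iexp (\<xi> \<bullet> \<mu>) * complex_of_real (exp (- (\<xi> \<bullet> (\<Sigma> *\<^sub>v \<xi>)) / 2))"
  shows "prob {\<omega> \<in> space M. \<tau> \<le> Y \<omega> \<bullet> (inv_mat \<Sigma> *\<^sub>v Y \<omega>)} = Q \<tau> p (\<mu> \<bullet> (inv_mat \<Sigma> *\<^sub>v \<mu>))"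
proof -
  have psd: "0 \<le> \<xi> \<bullet> (\<Sigma> *\<^sub>v \<xi>)" if "\<xi> \<in> carrier_vec p" for \<xi>
  proof -
    have "cmod (\<integral>\<omega>. iexp (\<xi> \<bullet> Y \<omega>) \<partial>M) \<le> (\<integral>\<omega>. cmod (iexp (\<xi> \<bullet> Y \<omega>)) \<partial>M)"
      by (rule integral_norm_bound)
    then have "exp (- (\<xi> \<bullet> (\<Sigma> *\<^sub>v \<xi>)) / 2) \<le> 1"
      unfolding ch[OF that] by (simp add: norm_mult prob_space)
    then show ?thesis by simp
  qed
  obtain H where H: "H \<in> carrier_mat p p" "inv_mat \<Sigma> = H\<^sup>T * H" "H * (\<Sigma> * H\<^sup>T) = 1\<^sub>m p"
    using whitening_mat[OF \<Sigma>(1,2) psd \<Sigma>(3)] by blast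
  have cY: "Y \<omega> \<in> carrier_vec p" if "\<omega> \<in> space M" for \<omega> using measurable_space[OF Y that] by simp
  have form: "y \<bullet> (inv_mat \<Sigma> *\<^sub>v y) = (\<Sum>j<p. ((H *\<^sub>v y) $ j)\<^sup>2)" if y: "y \<in> carrier_vec p" for y
  proof -
    have Hy: "H *\<^sub>v y \<in> carrier_vec p" using H y by simp
    have "y \<bullet> (inv_mat \<Sigma> *\<^sub>v y) = y \<bullet> (H\<^sup>T *\<^sub>v (H *\<^sub>v y))" using H y by simp
    also have "\<dots> = (H *\<^sub>v y) \<bullet> (H *\<^sub>v y)"
      using transpose_vec_mult_scalar[of "H\<^sup>T" p p "H *\<^sub>v y" y] H y Hy by simp
    also have "\<dots> = (\<Sum>j<p. ((H *\<^sub>v y) $ j)\<^sup>2)" using Hy by (simp add: scalar_prod_sum power2_eq_square)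
    finally show ?thesis .
  qed
  have lin: "(\<Sum>j<p. \<eta> j * (H *\<^sub>v y) $ j) = (H\<^sup>T *\<^sub>v vec p \<eta>) \<bullet> y" if "y \<in> carrier_vec p" for \<eta> y
    using transpose_vec_mult_scalar[OF H(1) that, of "vec p \<eta>"] H that
    by (simp add: scalar_prod_sum[of _ p])
  have "prob {\<omega> \<in> space M. \<tau> \<le> Y \<omega> \<bullet> (inv_mat \<Sigma> *\<^sub>v Y \<omega>)}
      = prob {\<omega> \<in> space M. \<tau> \<le> (\<Sum>j<p. ((H *\<^sub>v Y \<omega>) $ j)\<^sup>2)}"
    using form cY by (intro arg_cong[where f = prob]) auto
  also have "\<dots> = Q \<tau> p (\<Sum>j<p. ((H *\<^sub>v \<mu>) $ j)\<^sup>2)"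
  proof (rule prob_sum_squares_ge[OF p])
    fix j assume j: "j < p"
    have "(\<lambda>\<omega>. (H *\<^sub>v Y \<omega>) $ j) = (\<lambda>\<omega>. row H j \<bullet> Y \<omega>)" using j H by auto
    then show "(\<lambda>\<omega>. (H *\<^sub>v Y \<omega>) $ j) \<in> borel_measurable M"
      using measurable_compose[OF Y measurable_scalar_prod] by simp
  next
    fix \<eta> :: "nat \<Rightarrow> real"
    let ?\<xi> = "H\<^sup>T *\<^sub>v vec p \<eta>"
    have \<xi>: "?\<xi> \<in> carrier_vec p" using H by simp
    have "(\<integral>\<omega>. iexp (\<Sum>j<p. \<eta> j * (H *\<^sub>v Y \<omega>) $ j) \<partial>M) = (\<integral>\<omega>. iexp (?\<xi> \<bullet> Y \<omega>) \<partial>M)"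
      using lin cY by (intro Bochner_Integration.integral_cong) auto
    also have "\<dots> = iexp (?\<xi> \<bullet> \<mu>) * complex_of_real (exp (- (?\<xi> \<bullet> (\<Sigma> *\<^sub>v ?\<xi>)) / 2))" by (rule ch[OF \<xi>])
    also have "?\<xi> \<bullet> \<mu> = (\<Sum>j<p. \<eta> j * (H *\<^sub>v \<mu>) $ j)" using lin[OF \<mu>] by simp
    also have "?\<xi> \<bullet> (\<Sigma> *\<^sub>v ?\<xi>) = vec p \<eta> \<bullet> (H *\<^sub>v (\<Sigma> *\<^sub>v ?\<xi>))"
      using transpose_vec_mult_scalar[OF H(1), of "\<Sigma> *\<^sub>v ?\<xi>" "vec p \<eta>"] \<Sigma> \<xi> by simp
    also have "H *\<^sub>v (\<Sigma> *\<^sub>v ?\<xi>) = (H * (\<Sigma> * H\<^sup>T)) *\<^sub>v vec p \<eta>"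
      using H(1) \<Sigma>(1) by (simp add: assoc_mult_mat_vec[of _ p p _ p])
    also have "vec p \<eta> \<bullet> \<dots> = (\<Sum>j<p. (\<eta> j)\<^sup>2)"
      unfolding H(3) by (simp add: scalar_prod_sum[of _ p] power2_eq_square)
    finally show "(\<integral>\<omega>. iexp (\<Sum>j<p. \<eta> j * (H *\<^sub>v Y \<omega>) $ j) \<partial>M)
        = iexp (\<Sum>j<p. \<eta> j * (H *\<^sub>v \<mu>) $ j) * complex_of_real (exp (- (\<Sum>j<p. (\<eta> j)\<^sup>2) / 2))" .
  qed
  also have "(\<Sum>j<p. ((H *\<^sub>v \<mu>) $ j)\<^sup>2) = \<mu> \<bullet> (inv_mat \<Sigma> *\<^sub>v \<mu>)" using form[OF \<mu>] by simp
  finally show ?thesis .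
qed

section \<open>Products of block matrices and stacked vectors\<close>

lemma vec_of_list_append: "vec_of_list (xs @ ys) = vec_of_list xs @\<^sub>v vec_of_list ys"
  by (intro eq_vecI) (auto simp: vec_of_list_index nth_append)

lemma stack_vecs_Nil [simp]: "stack_vecs [] = 0\<^sub>v 0"
  by (intro eq_vecI) (auto simp: stack_vecs_def)

lemma stack_vecs_Cons [simp]: "stack_vecs (x # xs) = x @\<^sub>v stack_vecs xs"
  by (simp add: stack_vecs_def vec_of_list_append vec_list)

lemma dim_stack_vecs [simp]: "dim_vec (stack_vecs xs) = (\<Sum>x\<leftarrow>xs. dim_vec x)"
  by (induction xs) auto

lemma stack_vecs_singleton: "stack_vecs [x] = x"
  by (intro eq_vecI) auto

lemma stack_vecs_carrier:
  "(\<And>i. i \<in> set l \<Longrightarrow> f i \<in> carrier_vec (n i)) \<Longrightarrow> stack_vecs (map f l) \<in> carrier_vec (\<Sum>i\<leftarrow>l. n i)"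
  by (induction l) auto

lemma stack_vecs_add:
  "(\<And>i. i \<in> set l \<Longrightarrow> f i \<in> carrier_vec (n i) \<and> g i \<in> carrier_vec (n i)) \<Longrightarrow>
    stack_vecs (map f l) + stack_vecs (map g l) = stack_vecs (map (\<lambda>i. f i + g i) l)"
  for f :: "'i \<Rightarrow> real vec"
proof (induction l)
  case (Cons i l)
  have c: "stack_vecs (map f l) \<in> carrier_vec (\<Sum>i\<leftarrow>l. n i)" "stack_vecs (map g l) \<in> carrier_vec (\<Sum>i\<leftarrow>l. n i)"
    by (rule stack_vecs_carrier, use Cons.prems in auto)+
  show ?case using append_vec_add[OF _ _ c, of "f i" "n i" "g i"] Cons by simp
qed auto

lemma scalar_prod_stack_vecs:
  "(\<And>i. i \<in> set l \<Longrightarrow> f i \<in> carrier_vec (n i) \<and> g i \<in> carrier_vec (n i)) \<Longrightarrow>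
    stack_vecs (map f l) \<bullet> stack_vecs (map g l) = (\<Sum>i\<leftarrow>l. f i \<bullet> g i)"
  for f :: "'i \<Rightarrow> real vec"
proof (induction l)
  case (Cons i l)
  have c: "stack_vecs (map f l) \<in> carrier_vec (\<Sum>i\<leftarrow>l. n i)" "stack_vecs (map g l) \<in> carrier_vec (\<Sum>i\<leftarrow>l. n i)"
    by (rule stack_vecs_carrier, use Cons.prems in auto)+
  show ?case using scalar_prod_append[OF _ c(1) _ c(2), of "f i" "n i" "g i"] Cons by simp
qed simp

text \<open>A test vector paired with stacked noise has to be cut along the blocks of the noise.\<close>

lemma vec_unstack:
  fixes a :: "real vec"
  assumes "a \<in> carrier_vec (\<Sum>i\<leftarrow>l. n i)" "distinct l"
  obtains \<alpha> where "a = stack_vecs (map \<alpha> l)" "\<And>i. i \<in> set l \<Longrightarrow> \<alpha> i \<in> carrier_vec (n i)"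
proof -
  have "\<exists>\<alpha>. a = stack_vecs (map \<alpha> l) \<and> (\<forall>i\<in>set l. \<alpha> i \<in> carrier_vec (n i))"
    using assms
  proof (induction l arbitrary: a)
    case (Cons i l)
    let ?N = "\<Sum>i\<leftarrow>l. n i"
    obtain \<alpha> where \<alpha>: "vec_last a ?N = stack_vecs (map \<alpha> l)" "\<forall>i\<in>set l. \<alpha> i \<in> carrier_vec (n i)"
      using Cons.IH[of "vec_last a ?N"] Cons.prems(2) by auto
    have "a = vec_first a (n i) @\<^sub>v vec_last a ?N"
      using Cons.prems(1) by simp
    moreover have "map (\<alpha>(i := vec_first a (n i))) l = map \<alpha> l"
      using Cons.prems(2) by simp
    ultimately have "a = stack_vecs (map (\<alpha>(i := vec_first a (n i))) (i # l))"
      by (simp only: list.map stack_vecs_Cons fun_upd_same \<alpha>(1)[symmetric])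
    moreover have "\<forall>k\<in>set (i # l). (\<alpha>(i := vec_first a (n i))) k \<in> carrier_vec (n k)"
      using \<alpha>(2) by simp
    ultimately show ?case by blast
  qed auto
  then show ?thesis using that by blast
qed

text \<open>Sums of vectors of a given dimension: the dimension is an argument because an empty sum must be the zero
  vector of the right length.\<close>

definition vsum :: "nat \<Rightarrow> ('i \<Rightarrow> real vec) \<Rightarrow> 'i list \<Rightarrow> real vec" where
  "vsum n f l = foldr (\<lambda>i s. f i + s) l (0\<^sub>v n)"

lemma vsum_Nil [simp]: "vsum n f [] = 0\<^sub>v n"
  and vsum_Cons [simp]: "vsum n f (i # l) = f i + vsum n f l"
  by (simp_all add: vsum_def)

lemma vsum_carrier [simp]: "(\<And>i. i \<in> set l \<Longrightarrow> f i \<in> carrier_vec n) \<Longrightarrow> vsum n f l \<in> carrier_vec n"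
  by (induction l) auto

lemma vsum_cong: "l = l' \<Longrightarrow> (\<And>i. i \<in> set l' \<Longrightarrow> f i = g i) \<Longrightarrow> vsum n f l = vsum n g l'"
  by (induction l arbitrary: l') auto

lemma vsum_index:
  "(\<And>i. i \<in> set l \<Longrightarrow> f i \<in> carrier_vec n) \<Longrightarrow> r < n \<Longrightarrow> vsum n f l $ r = (\<Sum>i\<leftarrow>l. f i $ r)"
proof (induction l)
  case (Cons i l)
  have "vsum n f l \<in> carrier_vec n" using Cons.prems by (intro vsum_carrier) auto
  moreover have "f i \<in> carrier_vec n" using Cons.prems by simp
  ultimately have "(f i + vsum n f l) $ r = f i $ r + vsum n f l $ r"
    using Cons.prems(2) by simp
  then show ?case using Cons by simp
qed simp

lemma vsum_append:
  "(\<And>i. i \<in> set (l @ l') \<Longrightarrow> f i \<in> carrier_vec n) \<Longrightarrow> vsum n f (l @ l') = vsum n f l + vsum n f l'"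
proof (induction l)
  case (Cons i l)
  have "f i \<in> carrier_vec n" "vsum n f l \<in> carrier_vec n" "vsum n f l' \<in> carrier_vec n"
    using Cons.prems by auto
  then show ?case using Cons by (simp add: assoc_add_vec[of _ n])
qed auto

lemma vsum_zero: "(\<And>i. i \<in> set l \<Longrightarrow> f i = 0\<^sub>v n) \<Longrightarrow> vsum n f l = 0\<^sub>v n"
  by (induction l) auto

lemma mult_mat_vec_vsum:
  "A \<in> carrier_mat m n \<Longrightarrow> (\<And>i. i \<in> set l \<Longrightarrow> f i \<in> carrier_vec n) \<Longrightarrow>
    A *\<^sub>v vsum n f l = vsum m (\<lambda>i. A *\<^sub>v f i) l"
proof (induction l)
  case Nil
  then show ?case by auto
next
  case (Cons i l)
  then show ?case using mult_add_distrib_mat_vec[OF Cons.prems(1), of "f i" "vsum n f l"] by auto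
qed

lemma zero_mat_mult_vec: "x \<in> carrier_vec n \<Longrightarrow> 0\<^sub>m m n *\<^sub>v x = 0\<^sub>v m"
  for x :: "real vec"
  by (intro eq_vecI) (auto simp: scalar_prod_def)

lemma mat_of_rows_mult_vec:
  "set rs \<subseteq> carrier_vec n \<Longrightarrow> mat_of_rows n rs *\<^sub>v x = vec_of_list (map (\<lambda>r. r \<bullet> x) rs)"
  by (intro eq_vecI) (auto simp: vec_of_list_index subset_eq)

lemma stack_rows_mult_vec:
  assumes "\<And>M. M \<in> set Ms \<Longrightarrow> dim_col M = n"
  shows "stack_rows n Ms *\<^sub>v x = stack_vecs (map (\<lambda>M. M *\<^sub>v x) Ms)"
proof -
  have "map (\<lambda>r. r \<bullet> x) (rows M) = list_of_vec (M *\<^sub>v x)" for M :: "real mat"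
    by (simp add: rows_def mult_mat_vec_def)
  moreover have "set (concat (map rows Ms)) \<subseteq> carrier_vec n"
    using assms by (force simp: rows_def)
  ultimately show ?thesis
    unfolding stack_rows_def stack_vecs_def
    by (subst mat_of_rows_mult_vec) (simp_all add: map_concat comp_def del: vec_of_list_map)
qed

lemma stack_cols_carrier:
  assumes "\<And>i. i \<in> set l \<Longrightarrow> F i \<in> carrier_mat m (n i)"
  shows "stack_cols m (map F l) \<in> carrier_mat m (\<Sum>i\<leftarrow>l. n i)"
proof -
  have "length (concat (map cols (map F l))) = (\<Sum>i\<leftarrow>l. n i)"
    using assms by (induction l) auto
  then show ?thesis unfolding stack_cols_def by (metis mat_of_cols_carrier(1))
qed

lemma stack_cols_mult_stack_vecs:
  assumes "\<And>i. i \<in> set l \<Longrightarrow> F i \<in> carrier_mat m (n i) \<and> x i \<in> carrier_vec (n i)"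
  shows "stack_cols m (map F l) *\<^sub>v stack_vecs (map x l) = vsum m (\<lambda>i. F i *\<^sub>v x i) l"
  using assms
proof (induction l)
  case Nil
  show ?case by (intro eq_vecI) (auto simp: stack_cols_def)
next
  case (Cons i l)
  let ?R = "stack_cols m (map F l)" and ?y = "stack_vecs (map x l)"
  have F: "F i \<in> carrier_mat m (n i)" "x i \<in> carrier_vec (n i)" using Cons.prems by auto
  have len: "length (concat (map cols (map F l))) = (\<Sum>i\<leftarrow>l. n i)"
    using stack_cols_carrier[of l F m n] Cons.prems by (auto simp: stack_cols_def)
  have row: "row (mat_of_cols m cs) r = vec_of_list (map (\<lambda>c. c $ r) cs)" if "r < m" for cs :: "real vec list" and r
    using that by (intro eq_vecI) (auto simp: mat_of_cols_index vec_of_list_index)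
  have "stack_cols m (map F (i # l)) *\<^sub>v stack_vecs (map x (i # l)) = F i *\<^sub>v x i + ?R *\<^sub>v ?y"
  proof (intro eq_vecI)
    fix r assume "r < dim_vec (F i *\<^sub>v x i + ?R *\<^sub>v ?y)"
    then have r: "r < m" by (simp add: stack_cols_def)
    have c: "vec_of_list (map (\<lambda>c. c $ r) (concat (map cols (map F l)))) \<in> carrier_vec (\<Sum>i\<leftarrow>l. n i)"
      by (metis carrier_vecI dim_vec_of_list len length_map)
    have y: "?y \<in> carrier_vec (\<Sum>i\<leftarrow>l. n i)"
      using Cons.prems by (intro stack_vecs_carrier) auto
    have rowF: "vec_of_list (map (\<lambda>c. c $ r) (cols (F i))) = row (F i) r"
      using F r by (intro eq_vecI) (auto simp: vec_of_list_index cols_def)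
    have "(stack_cols m (map F (i # l)) *\<^sub>v stack_vecs (map x (i # l))) $ r
        = vec_of_list (map (\<lambda>c. c $ r) (cols (F i) @ concat (map cols (map F l)))) \<bullet> (x i @\<^sub>v ?y)"
      using r by (simp add: stack_cols_def row del: vec_of_list_map)
    also have "\<dots> = row (F i) r \<bullet> x i + vec_of_list (map (\<lambda>c. c $ r) (concat (map cols (map F l)))) \<bullet> ?y"
      unfolding map_append vec_of_list_append rowF using F r c y
      by (intro scalar_prod_append) auto
    also have "\<dots> = (F i *\<^sub>v x i + ?R *\<^sub>v ?y) $ r"
      using r F by (simp add: stack_cols_def row del: vec_of_list_map)
    finally show "(stack_cols m (map F (i # l)) *\<^sub>v stack_vecs (map x (i # l))) $ r = (F i *\<^sub>v x i + ?R *\<^sub>v ?y) $ r" .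
  qed (use F in \<open>simp add: stack_cols_def\<close>)
  then show ?case using Cons by simp
qed

lemma stack_rows_carrier:
  assumes "\<And>i. i \<in> set l \<Longrightarrow> dim_row (F i) = m i"
  shows "stack_rows n (map F l) \<in> carrier_mat (\<Sum>i\<leftarrow>l. m i) n"
proof -
  have "length (concat (map rows (map F l))) = (\<Sum>i\<leftarrow>l. m i)"
    using assms by (induction l) auto
  then show ?thesis unfolding stack_rows_def by (metis mat_of_rows_carrier(1))
qed

lemma block_mat_carrier:
  assumes "\<And>i j. i \<in> set I \<Longrightarrow> j \<in> set J \<Longrightarrow> F i j \<in> carrier_mat (m i) (n j)"
  shows "block_mat m n I J F \<in> carrier_mat (\<Sum>i\<leftarrow>I. m i) (\<Sum>j\<leftarrow>J. n j)"
  unfolding block_mat_def by (rule stack_rows_carrier) (simp add: stack_cols_def)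

lemma block_mat_mult_stack_vecs:
  assumes F: "\<And>i j. i \<in> set I \<Longrightarrow> j \<in> set J \<Longrightarrow> F i j \<in> carrier_mat (m i) (n j)"
    and x: "\<And>j. j \<in> set J \<Longrightarrow> x j \<in> carrier_vec (n j)"
  shows "block_mat m n I J F *\<^sub>v stack_vecs (map x J)
    = stack_vecs (map (\<lambda>i. vsum (m i) (\<lambda>j. F i j *\<^sub>v x j) J) I)"
proof -
  have "stack_cols (m i) (map (F i) J) *\<^sub>v stack_vecs (map x J) = vsum (m i) (\<lambda>j. F i j *\<^sub>v x j) J"
    if "i \<in> set I" for i
    using F x that by (intro stack_cols_mult_stack_vecs) auto
  moreover have "dim_col (stack_cols (m i) (map (F i) J)) = (\<Sum>j\<leftarrow>J. n j)" if "i \<in> set I" for i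
    using stack_cols_carrier[of J "F i" "m i" n] F that by auto
  ultimately show ?thesis
    unfolding block_mat_def
    by (subst stack_rows_mult_vec) (auto intro!: arg_cong[where f = stack_vecs])
qed

lemma diag_block_mat_carrier:
  assumes "\<And>i. i \<in> set l \<Longrightarrow> F i \<in> carrier_mat (m i) (n i)"
  shows "diag_block_mat (map F l) \<in> carrier_mat (\<Sum>i\<leftarrow>l. m i) (\<Sum>i\<leftarrow>l. n i)"
  using assms by (induction l) (auto simp: Let_def)

lemma diag_block_mat_mult_stack_vecs:
  assumes "\<And>i. i \<in> set l \<Longrightarrow> F i \<in> carrier_mat (m i) (n i) \<and> x i \<in> carrier_vec (n i)"
  shows "diag_block_mat (map F l) *\<^sub>v stack_vecs (map x l) = stack_vecs (map (\<lambda>i. F i *\<^sub>v x i) l)"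
  using assms
proof (induction l)
  case Nil
  show ?case by auto
next
  case (Cons i l)
  have F: "F i \<in> carrier_mat (m i) (n i)" "x i \<in> carrier_vec (n i)" using Cons.prems by auto
  have D: "diag_block_mat (map F l) \<in> carrier_mat (\<Sum>i\<leftarrow>l. m i) (\<Sum>i\<leftarrow>l. n i)"
    using Cons.prems by (intro diag_block_mat_carrier) auto
  have y: "stack_vecs (map x l) \<in> carrier_vec (\<Sum>i\<leftarrow>l. n i)"
    using Cons.prems by (intro stack_vecs_carrier) auto
  have DY: "diag_block_mat (map F l) *\<^sub>v stack_vecs (map x l) \<in> carrier_vec (\<Sum>i\<leftarrow>l. m i)"
    using D y by auto
  have FX: "F i *\<^sub>v x i \<in> carrier_vec (m i)" using F by auto
  have "diag_block_mat (map F (i # l)) *\<^sub>v stack_vecs (map x (i # l))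
      = (F i *\<^sub>v x i) @\<^sub>v (diag_block_mat (map F l) *\<^sub>v stack_vecs (map x l))"
  proof -
    have "0\<^sub>m (m i) (\<Sum>i\<leftarrow>l. n i) *\<^sub>v stack_vecs (map x l) = 0\<^sub>v (m i)"
      "0\<^sub>m (\<Sum>i\<leftarrow>l. m i) (n i) *\<^sub>v x i = 0\<^sub>v (\<Sum>i\<leftarrow>l. m i)"
      using F y by (auto intro!: zero_mat_mult_vec)
    then show ?thesis
      using D F FX DY y four_block_mat_mult_vec[OF F(1) zero_carrier_mat zero_carrier_mat D F(2) y]
      by (simp add: Let_def)
  qed
  then show ?case using Cons by simp
qed

text \<open>This reduces quadratic forms in \<open>I\<^sub>T \<otimes> P\<close> to the block diagonal case. The identity matrix is indexed by
  the length of a list so that the lemma applies to stacks over any list of times.\<close>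

lemma kronecker_one_mat: "kronecker (1\<^sub>m (length l)) P = diag_block_mat (map (\<lambda>_. P) l)"
proof (induction l)
  case Nil
  show ?case by (intro eq_matI) (auto simp: kronecker_def)
next
  case (Cons x l)
  let ?r = "dim_row P" and ?c = "dim_col P" and ?T = "length l"
  have div0: "i div d = 0 \<and> i mod d = i" if "i < d" for i d :: nat using that by simp
  have divS: "i div d = Suc ((i - d) div d) \<and> i mod d = (i - d) mod d" if "\<not> i < d" "d > 0" for i d :: nat
    using that by (simp add: le_div_geq le_mod_geq)
  have divl: "i div d < Suc ?T" if "i < d + ?T * d" for i d :: nat
    using that by (cases "d = 0") (auto simp: div_less_iff_less_mult)
  have "kronecker (1\<^sub>m (length (x # l))) P
      = four_block_mat P (0\<^sub>m ?r (?T * ?c)) (0\<^sub>m (?T * ?r) ?c) (kronecker (1\<^sub>m ?T) P)"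
  proof (intro eq_matI)
    fix i j
    assume "i < dim_row (four_block_mat P (0\<^sub>m ?r (?T * ?c)) (0\<^sub>m (?T * ?r) ?c) (kronecker (1\<^sub>m ?T) P))"
      and "j < dim_col (four_block_mat P (0\<^sub>m ?r (?T * ?c)) (0\<^sub>m (?T * ?r) ?c) (kronecker (1\<^sub>m ?T) P))"
    then have ij: "i < ?r + ?T * ?r" "j < ?c + ?T * ?c" by (simp_all add: kronecker_def)
    then have pos: "?r > 0" "?c > 0" by (auto intro: gr0I)
    have sub: "\<not> i < ?r \<Longrightarrow> i - ?r < ?T * ?r" "\<not> j < ?c \<Longrightarrow> j - ?c < ?T * ?c" using ij by auto
    then have subdiv: "\<not> i < ?r \<Longrightarrow> (i - ?r) div ?r < ?T" "\<not> j < ?c \<Longrightarrow> (j - ?c) div ?c < ?T"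
      using pos by (simp_all add: div_less_iff_less_mult)
    have "kronecker (1\<^sub>m (length (x # l))) P $$ (i, j)
        = (if i div ?r = j div ?c then 1 else 0) * P $$ (i mod ?r, j mod ?c)"
      using ij divl[OF ij(1)] divl[OF ij(2)] by (simp add: kronecker_def)
    also have "\<dots> = four_block_mat P (0\<^sub>m ?r (?T * ?c)) (0\<^sub>m (?T * ?r) ?c) (kronecker (1\<^sub>m ?T) P) $$ (i, j)"
      using ij pos sub subdiv div0[of i ?r] div0[of j ?c] divS[of i ?r] divS[of j ?c]
      by (cases "i < ?r"; cases "j < ?c") (auto simp: kronecker_def)
    finally show "kronecker (1\<^sub>m (length (x # l))) P $$ (i, j)
      = four_block_mat P (0\<^sub>m ?r (?T * ?c)) (0\<^sub>m (?T * ?r) ?c) (kronecker (1\<^sub>m ?T) P) $$ (i, j)" .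
  qed (simp_all add: kronecker_def)
  moreover have "dim_row (kronecker (1\<^sub>m ?T) P) = ?T * ?r" "dim_col (kronecker (1\<^sub>m ?T) P) = ?T * ?c"
    by (simp_all add: kronecker_def)
  ultimately show ?case using Cons.IH by (simp add: Let_def)
qed

lemma lower_toeplitz_carrier:
  assumes "\<And>d. F d \<in> carrier_mat p q"
  shows "lower_toeplitz T p q F \<in> carrier_mat (T * p) (T * q)"
proof -
  have "lower_toeplitz T p q F \<in> carrier_mat (\<Sum>i\<leftarrow>[1..<T+1]. p) (\<Sum>j\<leftarrow>[1..<T+1]. q)"
    unfolding lower_toeplitz_def by (rule block_mat_carrier) (use assms in auto)
  then show ?thesis by (simp add: sum_list_triv del: upt_Suc)
qed

text \<open>Multiplication by a block Toeplitz matrix is convolution, which is the form in which the solution of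
  the state recursion appears.\<close>

lemma lower_toeplitz_mult_stack_vecs:
  assumes F: "\<And>d. F d \<in> carrier_mat p q" and u: "\<And>k. k \<in> {1..T} \<Longrightarrow> u k \<in> carrier_vec q"
  shows "lower_toeplitz T p q F *\<^sub>v stack_vecs (map u [1..<T+1])
    = stack_vecs (map (\<lambda>j. vsum p (\<lambda>k. F (j - k) *\<^sub>v u k) [1..<j+1]) [1..<T+1])"
proof -
  let ?G = "\<lambda>j k. if k \<le> j then F (j - k) else 0\<^sub>m p q"
  have "lower_toeplitz T p q F *\<^sub>v stack_vecs (map u [1..<T+1])
      = stack_vecs (map (\<lambda>j. vsum p (\<lambda>k. ?G j k *\<^sub>v u k) [1..<T+1]) [1..<T+1])"
    unfolding lower_toeplitz_def by (rule block_mat_mult_stack_vecs) (use F u in auto)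
  also have "\<dots> = stack_vecs (map (\<lambda>j. vsum p (\<lambda>k. F (j - k) *\<^sub>v u k) [1..<j+1]) [1..<T+1])"
  proof (intro arg_cong[where f = stack_vecs] map_cong refl)
    fix j assume j: "j \<in> set [1..<T+1]"
    have split: "[1..<T+1] = [1..<j+1] @ [j+1..<T+1]"
      using j upt_add_eq_append[of 1 "j+1" "T - j"] by (auto simp del: upt_Suc)
    have car: "?G j k *\<^sub>v u k \<in> carrier_vec p" if "k \<in> set [1..<T+1]" for k
      using F u that by (auto intro!: mult_mat_vec_carrier)
    have "vsum p (\<lambda>k. ?G j k *\<^sub>v u k) [1..<T+1]
        = vsum p (\<lambda>k. ?G j k *\<^sub>v u k) [1..<j+1] + vsum p (\<lambda>k. ?G j k *\<^sub>v u k) [j+1..<T+1]"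
      using car unfolding split by (intro vsum_append)
    also have "vsum p (\<lambda>k. ?G j k *\<^sub>v u k) [j+1..<T+1] = 0\<^sub>v p"
      using u by (intro vsum_zero) (auto intro!: zero_mat_mult_vec)
    also have "vsum p (\<lambda>k. ?G j k *\<^sub>v u k) [1..<j+1] + 0\<^sub>v p = vsum p (\<lambda>k. ?G j k *\<^sub>v u k) [1..<j+1]"
      using F u j by (intro right_zero_vec vsum_carrier) (auto intro!: mult_mat_vec_carrier)
    also have "\<dots> = vsum p (\<lambda>k. F (j - k) *\<^sub>v u k) [1..<j+1]"
      by (intro vsum_cong) auto
    finally show "vsum p (\<lambda>k. ?G j k *\<^sub>v u k) [1..<T+1] = vsum p (\<lambda>k. F (j - k) *\<^sub>v u k) [1..<j+1]" .
  qed
  finally show ?thesis .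
qed

section \<open>Characteristic function of the stacked noise\<close>

lemma vec_unstack_nested:
  fixes c :: "real vec"
  assumes c: "c \<in> carrier_vec (length ks * (\<Sum>i\<leftarrow>l. n i))" and ks: "distinct ks" and l: "distinct l"
  obtains \<alpha> where "c = stack_vecs (map (\<lambda>k. stack_vecs (map (\<lambda>i. \<alpha> i k) l)) ks)"
    "\<And>i k. i \<in> set l \<Longrightarrow> k \<in> set ks \<Longrightarrow> \<alpha> i k \<in> carrier_vec (n i)"
proof -
  have "c \<in> carrier_vec (\<Sum>k\<leftarrow>ks. \<Sum>i\<leftarrow>l. n i)" using c by (simp add: sum_list_triv)
  then obtain \<gamma> where \<gamma>: "c = stack_vecs (map \<gamma> ks)" "\<And>k. k \<in> set ks \<Longrightarrow> \<gamma> k \<in> carrier_vec (\<Sum>i\<leftarrow>l. n i)"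
    using vec_unstack ks by blast
  have "\<exists>\<beta>. \<gamma> k = stack_vecs (map \<beta> l) \<and> (\<forall>i\<in>set l. \<beta> i \<in> carrier_vec (n i))" if "k \<in> set ks" for k
    using vec_unstack[OF \<gamma>(2)[OF that] l] by metis
  then obtain \<beta> where \<beta>: "\<forall>k\<in>set ks. \<gamma> k = stack_vecs (map (\<beta> k) l) \<and> (\<forall>i\<in>set l. \<beta> k i \<in> carrier_vec (n i))"
    by metis
  then have "map \<gamma> ks = map (\<lambda>k. stack_vecs (map (\<lambda>i. \<beta> k i) l)) ks" by simp
  then have "c = stack_vecs (map (\<lambda>k. stack_vecs (map (\<lambda>i. \<beta> k i) l)) ks)"
    by (rule trans[OF \<gamma>(1) arg_cong[where f = stack_vecs]])
  then show ?thesis using \<beta> that[of "\<lambda>i k. \<beta> k i"] by blast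
qed

lemma scalar_prod_stack_vecs_nested:
  fixes f g :: "'i \<Rightarrow> 'k \<Rightarrow> real vec"
  assumes fg: "\<And>i k. i \<in> set l \<Longrightarrow> k \<in> set ks \<Longrightarrow> f i k \<in> carrier_vec (n i) \<and> g i k \<in> carrier_vec (n i)"
    and ks: "distinct ks" and l: "distinct l"
  shows "stack_vecs (map (\<lambda>k. stack_vecs (map (\<lambda>i. f i k) l)) ks) \<bullet> stack_vecs (map (\<lambda>k. stack_vecs (map (\<lambda>i. g i k) l)) ks)
    = (\<Sum>(i, k)\<in>set l \<times> set ks. f i k \<bullet> g i k)"
proof -
  have "stack_vecs (map (\<lambda>k. stack_vecs (map (\<lambda>i. f i k) l)) ks) \<bullet> stack_vecs (map (\<lambda>k. stack_vecs (map (\<lambda>i. g i k) l)) ks)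
      = (\<Sum>k\<leftarrow>ks. stack_vecs (map (\<lambda>i. f i k) l) \<bullet> stack_vecs (map (\<lambda>i. g i k) l))"
    using fg by (intro scalar_prod_stack_vecs[where n = "\<lambda>_. \<Sum>i\<leftarrow>l. n i"] conjI stack_vecs_carrier) auto
  also have "\<dots> = (\<Sum>k\<leftarrow>ks. \<Sum>i\<leftarrow>l. f i k \<bullet> g i k)"
    using fg by (intro arg_cong[where f = sum_list] map_cong refl scalar_prod_stack_vecs[where n = n]) auto
  also have "\<dots> = (\<Sum>k\<in>set ks. \<Sum>i\<in>set l. f i k \<bullet> g i k)"
    using l ks by (simp add: sum_list_distinct_conv_sum_set)
  also have "\<dots> = (\<Sum>(i, k)\<in>set l \<times> set ks. f i k \<bullet> g i k)"
    by (subst sum.swap) (simp add: sum.cartesian_product)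
  finally show ?thesis .
qed

lemma quadratic_form_stack_vecs_nested:
  fixes f :: "'i \<Rightarrow> 'k \<Rightarrow> real vec"
  assumes f: "\<And>i k. i \<in> set l \<Longrightarrow> k \<in> set ks \<Longrightarrow> f i k \<in> carrier_vec (n i)"
    and P: "\<And>i. i \<in> set l \<Longrightarrow> P i \<in> carrier_mat (n i) (n i)" and ks: "distinct ks" and l: "distinct l"
  shows "stack_vecs (map (\<lambda>k. stack_vecs (map (\<lambda>i. f i k) l)) ks) \<bullet> (kronecker (1\<^sub>m (length ks)) (diag_block_mat (map P l))
        *\<^sub>v stack_vecs (map (\<lambda>k. stack_vecs (map (\<lambda>i. f i k) l)) ks))
    = (\<Sum>(i, k)\<in>set l \<times> set ks. f i k \<bullet> (P i *\<^sub>v f i k))"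
proof -
  have "kronecker (1\<^sub>m (length ks)) (diag_block_mat (map P l)) *\<^sub>v stack_vecs (map (\<lambda>k. stack_vecs (map (\<lambda>i. f i k) l)) ks)
      = stack_vecs (map (\<lambda>k. diag_block_mat (map P l) *\<^sub>v stack_vecs (map (\<lambda>i. f i k) l)) ks)"
    unfolding kronecker_one_mat using f P
    by (intro diag_block_mat_mult_stack_vecs[where m = "\<lambda>_. \<Sum>i\<leftarrow>l. n i" and n = "\<lambda>_. \<Sum>i\<leftarrow>l. n i"]
          conjI stack_vecs_carrier diag_block_mat_carrier) auto
  also have "\<dots> = stack_vecs (map (\<lambda>k. stack_vecs (map (\<lambda>i. P i *\<^sub>v f i k) l)) ks)"
    using f P by (intro arg_cong[where f = stack_vecs] map_cong refl diag_block_mat_mult_stack_vecs[where m = n and n = n]) auto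
  finally have eq: "kronecker (1\<^sub>m (length ks)) (diag_block_mat (map P l)) *\<^sub>v stack_vecs (map (\<lambda>k. stack_vecs (map (\<lambda>i. f i k) l)) ks)
      = stack_vecs (map (\<lambda>k. stack_vecs (map (\<lambda>i. P i *\<^sub>v f i k) l)) ks)" .
  show ?thesis
    unfolding eq by (rule scalar_prod_stack_vecs_nested[where n = n]) (use f P ks l in \<open>auto intro!: mult_mat_vec_carrier\<close>)
qed

text \<open>The exponent splits into terms that each involve the noise of one subsystem at one time. These are
  independent, so their characteristic functions multiply and their variances add up to the block
  diagonal quadratic forms. The list \<open>l\<close> of subsystems is \<open>[i]\<close> for a local detector and all
  subsystems for the centralized one.\<close>

lemma (in prob_space) stacked_noise_char:
  assumes noise: "gaussian_noise M S w v" and l: "distinct l" "set l \<subseteq> {1..nsub S}"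
    and a: "a \<in> carrier_vec (T * (\<Sum>i\<leftarrow>l. sdim S i))" and b: "b \<in> carrier_vec (T * (\<Sum>i\<leftarrow>l. odim S i))"
  shows "(\<integral>\<omega>. iexp (a \<bullet> stack_vecs (map (\<lambda>k. stack_vecs (map (\<lambda>i. w i k \<omega>) l)) [0..<T])
                + b \<bullet> stack_vecs (map (\<lambda>k. stack_vecs (map (\<lambda>i. v i k \<omega>) l)) [1..<T+1])) \<partial>M)
    = complex_of_real (exp (- (a \<bullet> (kronecker (1\<^sub>m T) (diag_block_mat (map (covw S) l)) *\<^sub>v a)
                             + b \<bullet> (kronecker (1\<^sub>m T) (diag_block_mat (map (covv S) l)) *\<^sub>v b)) / 2))"
proof -
  have gw: "gaussian_vec M (sdim S i) (w i k) (0\<^sub>v (sdim S i)) (covw S i)"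
    and gv: "gaussian_vec M (odim S i) (v i k) (0\<^sub>v (odim S i)) (covv S i)" if "i \<in> set l" for i k
    using noise l that unfolding gaussian_noise_def by auto
  have cw: "w i k \<omega> \<in> carrier_vec (sdim S i)" and cv: "v i k \<omega> \<in> carrier_vec (odim S i)"
    if "i \<in> set l" "\<omega> \<in> space M" for i k \<omega>
  proof -
    have "w i k \<in> measurable M (vec_borel (sdim S i))" "v i k \<in> measurable M (vec_borel (odim S i))"
      using gw[OF that(1)] gv[OF that(1)] unfolding gaussian_vec_def by blast+
    from this[THEN measurable_space, OF that(2)]
    show "w i k \<omega> \<in> carrier_vec (sdim S i)" "v i k \<omega> \<in> carrier_vec (odim S i)" by simp_all
  qed
  have covw: "covw S i \<in> carrier_mat (sdim S i) (sdim S i)" and covv: "covv S i \<in> carrier_mat (odim S i) (odim S i)"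
    if "i \<in> set l" for i
    using gw gv that gaussian_vec_cov by blast+
  obtain \<alpha> where \<alpha>: "a = stack_vecs (map (\<lambda>k. stack_vecs (map (\<lambda>i. \<alpha> i k) l)) [0..<T])"
    "\<And>i k. i \<in> set l \<Longrightarrow> k \<in> set [0..<T] \<Longrightarrow> \<alpha> i k \<in> carrier_vec (sdim S i)"
    using vec_unstack_nested[of a "[0..<T]" "sdim S" l] a l(1) by auto
  obtain \<beta> where \<beta>: "b = stack_vecs (map (\<lambda>k. stack_vecs (map (\<lambda>i. \<beta> i k) l)) [1..<T+1])"
    "\<And>i k. i \<in> set l \<Longrightarrow> k \<in> set [1..<T+1] \<Longrightarrow> \<beta> i k \<in> carrier_vec (odim S i)"
    using vec_unstack_nested[of b "[1..<T+1]" "odim S" l] b l(1) by (auto simp del: upt_Suc)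
  let ?I1 = "set l \<times> set [0..<T]" and ?I2 = "set l \<times> set [1..<T+1]"
  let ?I = "?I1 <+> ?I2"
  let ?\<gamma> = "case_sum (\<lambda>(i, k). \<alpha> i k) (\<lambda>(i, k). \<beta> i k)"
  let ?X = "case_sum (\<lambda>(i, k). w i k) (\<lambda>(i, k). v i k)"
  let ?C = "case_sum (\<lambda>(i, k). covw S i) (\<lambda>(i, k). covv S i)"
  let ?n = "case_sum (\<lambda>(i, k::nat). sdim S i) (\<lambda>(i, k::nat). odim S i)"
  have fin: "finite ?I" by simp
  have gX: "gaussian_vec M (?n z) (?X z) (0\<^sub>v (?n z)) (?C z)" and cz: "?\<gamma> z \<in> carrier_vec (?n z)" if "z \<in> ?I" for z
    using that gw gv \<alpha>(2) \<beta>(2) by (auto simp del: upt_Suc set_upt)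
  have ind: "indep_vars (\<lambda>z. vec_borel (?n z)) ?X ?I"
  proof -
    have "indep_vars (case_sum (\<lambda>(i, k). vec_borel (sdim S i)) (\<lambda>(i, k). vec_borel (odim S i))) ?X ?I"
      using noise l unfolding gaussian_noise_def by (auto elim!: indep_vars_subset)
    then show ?thesis
      by (subst (asm) indep_vars_cong[OF refl refl, where N' = "\<lambda>z. vec_borel (?n z)"]) (auto split: sum.splits)
  qed
  have indE: "indep_vars (\<lambda>_. borel) (\<lambda>z \<omega>. iexp (?\<gamma> z \<bullet> ?X z \<omega>)) ?I"
    by (rule indep_vars_compose2[OF ind, where Y = "\<lambda>z x. iexp (?\<gamma> z \<bullet> x)"])
       (intro measurable_compose[OF measurable_scalar_prod], simp)
  have meas: "(\<lambda>\<omega>. ?\<gamma> z \<bullet> ?X z \<omega>) \<in> borel_measurable M" if "z \<in> ?I" for z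
  proof -
    have "?X z \<in> measurable M (vec_borel (?n z))" using gX[OF that] unfolding gaussian_vec_def by simp
    from measurable_compose[OF this measurable_scalar_prod] show ?thesis .
  qed
  have exponent: "a \<bullet> stack_vecs (map (\<lambda>k. stack_vecs (map (\<lambda>i. w i k \<omega>) l)) [0..<T])
        + b \<bullet> stack_vecs (map (\<lambda>k. stack_vecs (map (\<lambda>i. v i k \<omega>) l)) [1..<T+1])
      = (\<Sum>z\<in>?I. ?\<gamma> z \<bullet> ?X z \<omega>)" if "\<omega> \<in> space M" for \<omega>
  proof -
    have "a \<bullet> stack_vecs (map (\<lambda>k. stack_vecs (map (\<lambda>i. w i k \<omega>) l)) [0..<T]) = (\<Sum>(i, k)\<in>?I1. \<alpha> i k \<bullet> w i k \<omega>)"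
      unfolding \<alpha>(1) by (rule scalar_prod_stack_vecs_nested[where n = "sdim S"]) (use \<alpha>(2) cw that l(1) in auto)
    moreover have "b \<bullet> stack_vecs (map (\<lambda>k. stack_vecs (map (\<lambda>i. v i k \<omega>) l)) [1..<T+1]) = (\<Sum>(i, k)\<in>?I2. \<beta> i k \<bullet> v i k \<omega>)"
      unfolding \<beta>(1) by (rule scalar_prod_stack_vecs_nested[where n = "odim S"]) (use \<beta>(2) cv that l(1) in \<open>auto simp del: upt_Suc\<close>)
    moreover have "(\<Sum>z\<in>?I. ?\<gamma> z \<bullet> ?X z \<omega>) = (\<Sum>(i, k)\<in>?I1. \<alpha> i k \<bullet> w i k \<omega>) + (\<Sum>(i, k)\<in>?I2. \<beta> i k \<bullet> v i k \<omega>)"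
      by (subst sum.Plus) (auto intro!: arg_cong2[where f = "(+)"] sum.cong simp del: upt_Suc)
    ultimately show ?thesis by simp
  qed
  have "(\<integral>\<omega>. iexp (a \<bullet> stack_vecs (map (\<lambda>k. stack_vecs (map (\<lambda>i. w i k \<omega>) l)) [0..<T])
                + b \<bullet> stack_vecs (map (\<lambda>k. stack_vecs (map (\<lambda>i. v i k \<omega>) l)) [1..<T+1])) \<partial>M)
      = (\<integral>\<omega>. (\<Prod>z\<in>?I. iexp (?\<gamma> z \<bullet> ?X z \<omega>)) \<partial>M)"
    using exponent exp_i_sum[OF fin] by (intro Bochner_Integration.integral_cong refl) (simp only:)
  also have "\<dots> = (\<Prod>z\<in>?I. \<integral>\<omega>. iexp (?\<gamma> z \<bullet> ?X z \<omega>) \<partial>M)"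
    using meas by (intro indep_vars_lebesgue_integral[OF fin indE] integrable_const_bound[where B = 1]) auto
  also have "\<dots> = (\<Prod>z\<in>?I. complex_of_real (exp (- (?\<gamma> z \<bullet> (?C z *\<^sub>v ?\<gamma> z)) / 2)))"
    by (intro prod.cong refl gaussian_vec_char[OF gX cz])
  also have "\<dots> = complex_of_real (exp (- (\<Sum>z\<in>?I. ?\<gamma> z \<bullet> (?C z *\<^sub>v ?\<gamma> z)) / 2))"
    by (simp only: of_real_prod[symmetric] exp_sum[OF fin, symmetric] sum_negf[symmetric] sum_divide_distrib)
  also have "(\<Sum>z\<in>?I. ?\<gamma> z \<bullet> (?C z *\<^sub>v ?\<gamma> z))
      = (\<Sum>(i, k)\<in>?I1. \<alpha> i k \<bullet> (covw S i *\<^sub>v \<alpha> i k)) + (\<Sum>(i, k)\<in>?I2. \<beta> i k \<bullet> (covv S i *\<^sub>v \<beta> i k))"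
    by (subst sum.Plus) (auto intro!: arg_cong2[where f = "(+)"] sum.cong simp del: upt_Suc)
  also have "(\<Sum>(i, k)\<in>?I1. \<alpha> i k \<bullet> (covw S i *\<^sub>v \<alpha> i k)) = a \<bullet> (kronecker (1\<^sub>m T) (diag_block_mat (map (covw S) l)) *\<^sub>v a)"
    using quadratic_form_stack_vecs_nested[of l "[0..<T]" \<alpha> "sdim S" "covw S"] \<alpha> covw l(1) by simp
  also have "(\<Sum>(i, k)\<in>?I2. \<beta> i k \<bullet> (covv S i *\<^sub>v \<beta> i k)) = b \<bullet> (kronecker (1\<^sub>m T) (diag_block_mat (map (covv S) l)) *\<^sub>v b)"
    using quadratic_form_stack_vecs_nested[of l "[1..<T+1]" \<beta> "odim S" "covv S"] \<beta> covv l(1) by (simp del: upt_Suc set_upt)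
  finally show ?thesis .
qed

section \<open>Response of a linear system over the horizon\<close>

text \<open>Inputs are indexed by the times \<open>0, \<dots>, T - 1\<close>, but the block columns of the response matrices by \<open>1, \<dots>, T\<close>.\<close>

lemma map_upt_shift: "map f [0..<T] = map (\<lambda>k. f (k - 1)) [1..<T+1]"
  by (intro nth_equalityI) (auto simp del: upt_Suc)

lemma pow_mat_Suc_mult_vec:
  "A \<in> carrier_mat n n \<Longrightarrow> x \<in> carrier_vec n \<Longrightarrow> A ^\<^sub>m Suc k *\<^sub>v x = A *\<^sub>v (A ^\<^sub>m k *\<^sub>v x)"
  for A :: "real mat"
proof (induction k arbitrary: x)
  case 0
  then show ?case by simp
next
  case (Suc k)
  have P: "A ^\<^sub>m k \<in> carrier_mat n n" for k using Suc.prems(1) by simp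
  have Ax: "A *\<^sub>v x \<in> carrier_vec n" using Suc.prems by simp
  have "A ^\<^sub>m Suc (Suc k) *\<^sub>v x = A ^\<^sub>m Suc k *\<^sub>v (A *\<^sub>v x)"
    using assoc_mult_mat_vec[OF P[of "Suc k"] Suc.prems] by simp
  also have "\<dots> = A *\<^sub>v (A ^\<^sub>m k *\<^sub>v (A *\<^sub>v x))" by (rule Suc.IH[OF Suc.prems(1) Ax])
  also have "A ^\<^sub>m k *\<^sub>v (A *\<^sub>v x) = A ^\<^sub>m Suc k *\<^sub>v x"
    using assoc_mult_mat_vec[OF P[of k] Suc.prems] by simp
  finally show ?case .
qed

lemma linear_recurrence_solution:
  fixes A :: "real mat"
  assumes A: "A \<in> carrier_mat n n" and x0: "x 0 \<in> carrier_vec n" and f: "\<And>k. f k \<in> carrier_vec n"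
    and step: "\<And>k. x (Suc k) = A *\<^sub>v x k + f k"
  shows "x k = A ^\<^sub>m k *\<^sub>v x 0 + vsum n (\<lambda>l. A ^\<^sub>m (k - l) *\<^sub>v f (l - 1)) [1..<k+1]"
proof (induction k)
  case 0
  then show ?case using A x0 by simp
next
  case (Suc k)
  have P: "A ^\<^sub>m k \<in> carrier_mat n n" for k using A by simp
  have c: "A ^\<^sub>m j *\<^sub>v f l \<in> carrier_vec n" for j l using P f by (rule mult_mat_vec_carrier)
  have c0: "A ^\<^sub>m j *\<^sub>v x 0 \<in> carrier_vec n" for j using P x0 by (rule mult_mat_vec_carrier)
  let ?r = "vsum n (\<lambda>l. A ^\<^sub>m (k - l) *\<^sub>v f (l - 1)) [1..<k+1]"
  have r: "?r \<in> carrier_vec n" using c by simp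
  have "A *\<^sub>v ?r = vsum n (\<lambda>l. A ^\<^sub>m (Suc k - l) *\<^sub>v f (l - 1)) [1..<k+1]"
    unfolding mult_mat_vec_vsum[OF A c]
    by (intro vsum_cong refl) (auto simp: pow_mat_Suc_mult_vec[OF A f, symmetric] Suc_diff_le simp del: pow_mat.simps upt_Suc)
  moreover have "vsum n (\<lambda>l. A ^\<^sub>m (Suc k - l) *\<^sub>v f (l - 1)) [1..<Suc k+1]
      = vsum n (\<lambda>l. A ^\<^sub>m (Suc k - l) *\<^sub>v f (l - 1)) [1..<k+1] + f k"
  proof -
    have "[1..<Suc k+1] = [1..<k+1] @ [Suc k]" by simp
    then show ?thesis
      using f[of k] A by (simp only:) (subst vsum_append, use c in auto)
  qed
  moreover have "x (Suc k) = A ^\<^sub>m Suc k *\<^sub>v x 0 + (A *\<^sub>v ?r + f k)"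
    using f[of k] A r c0
    by (subst step, subst Suc.IH)
       (simp add: mult_add_distrib_mat_vec[OF A] pow_mat_Suc_mult_vec[OF A x0] assoc_add_vec[of _ n] del: pow_mat.simps upt_Suc)
  ultimately show ?case by simp
qed

lemma noise_response_carrier:
  assumes "dynm D \<in> carrier_mat n n" "outm D \<in> carrier_mat q n"
  shows "noise_response T D \<in> carrier_mat (T * q) (T * n)"
  using lower_toeplitz_carrier[of "\<lambda>d. outm D * dynm D ^\<^sub>m d" q n T] assms by (simp add: noise_response_def)

lemma input_response_carrier:
  assumes "dynm D \<in> carrier_mat n n" "outm D \<in> carrier_mat q n" "B \<in> carrier_mat n m"
  shows "input_response T D B \<in> carrier_mat (T * q) (T * m)"
proof -
  have "outm D * dynm D ^\<^sub>m d * B \<in> carrier_mat q m" for d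
    using assms by (intro mult_carrier_mat[of _ q n]) auto
  from lower_toeplitz_carrier[OF this, of T] show ?thesis
    using assms by (simp add: input_response_def)
qed

lemma obs_mat_carrier:
  assumes "dynm D \<in> carrier_mat n n" "outm D \<in> carrier_mat q n"
  shows "obs_mat T D \<in> carrier_mat (T * q) n"
  using stack_rows_carrier[of "[1..<T+1]" "\<lambda>j. outm D * dynm D ^\<^sub>m j" "\<lambda>_. q" n] assms
  by (simp add: obs_mat_def sum_list_triv del: upt_Suc)

text \<open>An input entering through \<open>B\<close> acts like the process disturbance \<open>B u\<close>. Hence all inputs can be
  merged into one disturbance when the recursion is solved, and separated again afterwards.\<close>

lemma input_response_mult_stack_vecs:
  assumes A: "dynm D \<in> carrier_mat n n" and C: "outm D \<in> carrier_mat q n" and B: "B \<in> carrier_mat n m"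
    and u: "\<And>k. u k \<in> carrier_vec m"
  shows "input_response T D B *\<^sub>v stack_vecs (map u [0..<T])
    = noise_response T D *\<^sub>v stack_vecs (map (\<lambda>k. B *\<^sub>v u k) [0..<T])"
proof -
  have P: "outm D * dynm D ^\<^sub>m d \<in> carrier_mat q n" for d using A C by simp
  have PB: "outm D * dynm D ^\<^sub>m d * B \<in> carrier_mat q m" for d using P B by (rule mult_carrier_mat)
  have Bu: "B *\<^sub>v u k \<in> carrier_vec n" for k using B u by (rule mult_mat_vec_carrier)
  have "input_response T D B *\<^sub>v stack_vecs (map u [0..<T])
      = stack_vecs (map (\<lambda>j. vsum q (\<lambda>k. (outm D * dynm D ^\<^sub>m (j - k) * B) *\<^sub>v u (k - 1)) [1..<j+1]) [1..<T+1])"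
    using lower_toeplitz_mult_stack_vecs[of "\<lambda>d. outm D * dynm D ^\<^sub>m d * B" q m T "\<lambda>k. u (k - 1)"] PB B C u
    unfolding map_upt_shift[of u] by (simp add: input_response_def del: upt_Suc)
  also have "\<dots> = stack_vecs (map (\<lambda>j. vsum q (\<lambda>k. (outm D * dynm D ^\<^sub>m (j - k)) *\<^sub>v (B *\<^sub>v u (k - 1))) [1..<j+1]) [1..<T+1])"
    by (intro arg_cong[where f = stack_vecs] map_cong refl vsum_cong assoc_mult_mat_vec[OF P B u])
  also have "\<dots> = noise_response T D *\<^sub>v stack_vecs (map (\<lambda>k. B *\<^sub>v u k) [0..<T])"
    using lower_toeplitz_mult_stack_vecs[of "\<lambda>d. outm D * dynm D ^\<^sub>m d" q n T "\<lambda>k. B *\<^sub>v u (k - 1)"] P A C Bu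
    unfolding map_upt_shift[of "\<lambda>k. B *\<^sub>v u k"] by (simp add: noise_response_def del: upt_Suc)
  finally show ?thesis .
qed

lemma stacked_output:
  assumes A: "dynm D \<in> carrier_mat n n" and C: "outm D \<in> carrier_mat q n"
    and x0: "x 0 \<in> carrier_vec n" and f: "\<And>k. f k \<in> carrier_vec n" and e: "\<And>k. e k \<in> carrier_vec q"
    and step: "\<And>k. x (Suc k) = dynm D *\<^sub>v x k + f k"
  shows "stack_vecs (map (\<lambda>k. outm D *\<^sub>v x k + e k) [1..<T+1])
    = obs_mat T D *\<^sub>v x 0 + (noise_response T D *\<^sub>v stack_vecs (map f [0..<T]) + stack_vecs (map e [1..<T+1]))"
proof -
  have P: "outm D * dynm D ^\<^sub>m d \<in> carrier_mat q n" and Pd: "dynm D ^\<^sub>m d \<in> carrier_mat n n" for d using A C by simp_all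
  let ?r = "\<lambda>j. vsum q (\<lambda>k. (outm D * dynm D ^\<^sub>m (j - k)) *\<^sub>v f (k - 1)) [1..<j+1]"
  have r: "?r j \<in> carrier_vec q" for j by (intro vsum_carrier mult_mat_vec_carrier[OF P f])
  have ox: "(outm D * dynm D ^\<^sub>m j) *\<^sub>v x 0 \<in> carrier_vec q" for j by (rule mult_mat_vec_carrier[OF P x0])
  have out: "outm D *\<^sub>v x k + e k = (outm D * dynm D ^\<^sub>m k) *\<^sub>v x 0 + (?r k + e k)" for k
  proof -
    have c: "dynm D ^\<^sub>m j *\<^sub>v f l \<in> carrier_vec n" "dynm D ^\<^sub>m j *\<^sub>v x 0 \<in> carrier_vec n" for j l
      using mult_mat_vec_carrier[OF Pd] f x0 by auto
    have "outm D *\<^sub>v x k = outm D *\<^sub>v (dynm D ^\<^sub>m k *\<^sub>v x 0)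
        + outm D *\<^sub>v vsum n (\<lambda>l. dynm D ^\<^sub>m (k - l) *\<^sub>v f (l - 1)) [1..<k+1]"
      unfolding linear_recurrence_solution[of "dynm D" n x f k, OF A x0 f step]
      by (intro mult_add_distrib_mat_vec[OF C] c vsum_carrier)
    also have "\<dots> = (outm D * dynm D ^\<^sub>m k) *\<^sub>v x 0 + ?r k"
      unfolding mult_mat_vec_vsum[OF C c(1)] by (simp add: assoc_mult_mat_vec[OF C Pd] f x0 del: upt_Suc)
    finally show ?thesis using ox r e by (simp add: assoc_add_vec[of _ q])
  qed
  have "stack_vecs (map (\<lambda>k. outm D *\<^sub>v x k + e k) [1..<T+1])
      = stack_vecs (map (\<lambda>j. (outm D * dynm D ^\<^sub>m j) *\<^sub>v x 0) [1..<T+1])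
        + (stack_vecs (map ?r [1..<T+1]) + stack_vecs (map e [1..<T+1]))"
    unfolding out using r ox e
    by (subst stack_vecs_add[where n = "\<lambda>_. q"], simp, subst stack_vecs_add[where n = "\<lambda>_. q"]) auto
  also have "stack_vecs (map (\<lambda>j. (outm D * dynm D ^\<^sub>m j) *\<^sub>v x 0) [1..<T+1]) = obs_mat T D *\<^sub>v x 0"
    unfolding obs_mat_def using A by (subst stack_rows_mult_vec) (auto simp: comp_def)
  also have "stack_vecs (map ?r [1..<T+1]) = noise_response T D *\<^sub>v stack_vecs (map f [0..<T])"
    using lower_toeplitz_mult_stack_vecs[of "\<lambda>d. outm D * dynm D ^\<^sub>m d" q n T "\<lambda>k. f (k - 1)"] P A C f
    unfolding map_upt_shift[of f] by (simp add: noise_response_def del: upt_Suc)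
  finally show ?thesis .
qed

section \<open>Bases of left null spaces\<close>

lemma basis_rows_annihilate:
  assumes K: "rows_basis_left_null K G" and x: "x \<in> carrier_vec (dim_col G)"
  shows "K *\<^sub>v (G *\<^sub>v x) = 0\<^sub>v (dim_row K)"
proof (intro eq_vecI)
  interpret kernel "dim_col G" "dim_row G" "G\<^sup>T" by unfold_locales simp
  fix i assume "i < dim_vec (0\<^sub>v (dim_row K) :: real vec)"
  then have i: "i < dim_row K" by simp
  have "set (rows K) \<subseteq> mat_kernel (G\<^sup>T)"
    using K unfolding rows_basis_left_null_def left_null_space_def Ker.basis_def by blast
  then have "row K i \<in> mat_kernel (G\<^sup>T)" using i by (auto simp: rows_def)
  then have r: "row K i \<in> carrier_vec (dim_row G)" "G\<^sup>T *\<^sub>v row K i = 0\<^sub>v (dim_col G)"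
    by (auto simp: mat_kernel_def)
  have "row K i \<bullet> (G *\<^sub>v x) = (G\<^sup>T *\<^sub>v row K i) \<bullet> x"
    using transpose_vec_mult_scalar[of G "dim_row G" "dim_col G" x "row K i"] r x by simp
  then show "(K *\<^sub>v (G *\<^sub>v x)) $ i = 0\<^sub>v (dim_row K) $ i" using i r x by simp
qed simp

text \<open>This provides the positive number of degrees of freedom without which the test statistic would have
  an atom.\<close>

lemma basis_rows_nonempty:
  assumes K: "rows_basis_left_null K G" and ne: "left_null_space G \<noteq> {0\<^sub>v (dim_row G)}"
  shows "0 < dim_row K"
proof (rule ccontr)
  interpret kernel "dim_col G" "dim_row G" "G\<^sup>T" by unfold_locales simp
  assume "\<not> 0 < dim_row K"
  then have "set (rows K) = {}" by (simp add: rows_def)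
  then have "Ker.span {} = mat_kernel (G\<^sup>T)"
    using K unfolding rows_basis_left_null_def left_null_space_def Ker.basis_def by simp
  moreover have "Ker.span {} = {0\<^sub>v (dim_row G)}"
    by (auto simp: Ker.span_def Ker.lincomb_def)
  ultimately show False using ne by (simp add: left_null_space_def)
qed

section \<open>Alarm probability of a detector\<close>

lemma kronecker_one_carrier:
  "P \<in> carrier_mat m n \<Longrightarrow> kronecker (1\<^sub>m T) P \<in> carrier_mat (T * m) (T * n)"
  by (auto simp: kronecker_def)

lemma kronecker_one_symmetric:
  assumes P: "P \<in> carrier_mat n n" "P\<^sup>T = P"
  shows "(kronecker (1\<^sub>m T) P)\<^sup>T = kronecker (1\<^sub>m T) P"
proof (intro eq_matI)
  fix i j assume "i < dim_row (kronecker (1\<^sub>m T) P)" "j < dim_col (kronecker (1\<^sub>m T) P)"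
  then have ij: "i < T * n" "j < T * n" using P(1) by (auto simp: kronecker_def)
  then have n: "0 < n" by (auto intro: gr0I)
  have "P $$ (j mod n, i mod n) = P\<^sup>T $$ (i mod n, j mod n)" using P(1) n by simp
  then have "P $$ (j mod n, i mod n) = P $$ (i mod n, j mod n)" by (simp only: P(2))
  moreover have "i div n < T" "j div n < T" using ij n by (simp_all add: div_less_iff_less_mult)
  ultimately show "(kronecker (1\<^sub>m T) P)\<^sup>T $$ (i, j) = kronecker (1\<^sub>m T) P $$ (i, j)"
    using ij P(1) by (simp add: kronecker_def)
qed (use P(1) in \<open>simp_all add: kronecker_def\<close>)

lemma invertible_mat_rank:
  assumes A: "A \<in> carrier_mat n n" and inv: "invertible_mat A"
  shows "mat_rank A = n"
proof -
  have "det A * det (inv_mat A) = 1"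
    using det_mult[OF A inv_mat_works(1)[OF A inv]] inv_mat_works(2)[OF A inv] by simp
  then have "det A \<noteq> 0" by auto
  then show ?thesis using vec_space.det_rank_iff[OF A] A by (simp add: mat_rank_def)
qed

text \<open>The probabilistic core, common to the local and the centralized detector. The
  measurements \<open>Y\<close> enter through their projection by \<open>K\<close>, from which the nuisance terms are gone. The projected measurement then has
  the characteristic function of a Gaussian vector with mean \<open>\<mu>\<close> and covariance \<open>\<Sigma>\<close>: pairing with
  \<open>\<xi>\<close> amounts to pairing the noises with \<open>a\<close> and \<open>b\<close>, the images of \<open>\<xi>\<close> under the transposed matrices.\<close>

lemma (in prob_space) alarm_prob:
  fixes D :: detector_model and Y W V :: "'a \<Rightarrow> real vec"
  assumes A: "dynm D \<in> carrier_mat n n" and Ba: "attm D \<in> carrier_mat n m" and C: "outm D \<in> carrier_mat q n"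
    and Sw: "pcov D \<in> carrier_mat n n" "(pcov D)\<^sup>T = pcov D" and Sv: "mcov D \<in> carrier_mat q q" "(mcov D)\<^sup>T = mcov D"
    and K: "rows_basis_left_null K G" and G: "dim_row G = T * q" "left_null_space G \<noteq> {0\<^sub>v (dim_row G)}"
    and inv: "invertible_mat (test_cov T D K)"
    and U: "U \<in> carrier_vec (T * m)"
    and W: "W \<in> measurable M (vec_borel (T * n))" and V: "V \<in> measurable M (vec_borel (T * q))"
    and ch: "\<And>a b. a \<in> carrier_vec (T * n) \<Longrightarrow> b \<in> carrier_vec (T * q) \<Longrightarrow>
      (\<integral>\<omega>. iexp (a \<bullet> W \<omega> + b \<bullet> V \<omega>) \<partial>M)
        = complex_of_real (exp (- (a \<bullet> (kronecker (1\<^sub>m T) (pcov D) *\<^sub>v a) + b \<bullet> (kronecker (1\<^sub>m T) (mcov D) *\<^sub>v b)) / 2))"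
    and Y: "\<And>\<omega>. \<omega> \<in> space M \<Longrightarrow>
      K *\<^sub>v Y \<omega> = K *\<^sub>v (attack_response T D *\<^sub>v U + (noise_response T D *\<^sub>v W \<omega> + V \<omega>))"
  shows "\<P>(\<omega> in M. test_statistic T D K (Y \<omega>) \<ge> \<tau>) = Q \<tau> (dof T D K) (noncentrality T D K U)"
proof -
  define p where "p = dim_row K"
  define Fw where "Fw = noise_response T D"
  define Fa where "Fa = attack_response T D"
  define Pw where "Pw = kronecker (1\<^sub>m T) (pcov D)"
  define Pv where "Pv = kronecker (1\<^sub>m T) (mcov D)"
  define \<Sigma> where "\<Sigma> = test_cov T D K"
  have p: "0 < p" using basis_rows_nonempty[OF K G(2)] by (simp add: p_def)
  have Kc: "K \<in> carrier_mat p (T * q)" using K G(1) by (auto simp: rows_basis_left_null_def p_def)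
  have Fw: "Fw \<in> carrier_mat (T * q) (T * n)" using noise_response_carrier[OF A C] by (simp add: Fw_def)
  have Fa: "Fa \<in> carrier_mat (T * q) (T * m)" using input_response_carrier[OF A C Ba] by (simp add: Fa_def)
  have Pw: "Pw \<in> carrier_mat (T * n) (T * n)" "Pw\<^sup>T = Pw"
    using kronecker_one_carrier Sw kronecker_one_symmetric by (auto simp: Pw_def)
  have Pv: "Pv \<in> carrier_mat (T * q) (T * q)" "Pv\<^sup>T = Pv"
    using kronecker_one_carrier Sv kronecker_one_symmetric by (auto simp: Pv_def)
  have \<Sigma>_eq: "\<Sigma> = K * (Fw * Pw * Fw\<^sup>T + Pv) * K\<^sup>T"
    by (simp add: \<Sigma>_def test_cov_def Fw_def Pw_def Pv_def)
  have FPF: "Fw * Pw * Fw\<^sup>T \<in> carrier_mat (T * q) (T * q)"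
    using Fw Pw(1) by (intro mult_carrier_mat[of _ "T * q" "T * n"] transpose_carrier_mat[THEN iffD2])
  have \<Sigma>: "\<Sigma> \<in> carrier_mat p p" unfolding \<Sigma>_eq using Kc FPF Pv(1)
    by (intro mult_carrier_mat[of _ p "T * q"] add_carrier_mat transpose_carrier_mat[THEN iffD2])
  have "(Fw * Pw * Fw\<^sup>T)\<^sup>T = Fw * Pw * Fw\<^sup>T"
  proof -
    have "(Fw * Pw * Fw\<^sup>T)\<^sup>T = Fw * (Fw * Pw)\<^sup>T"
      using transpose_mult[of "Fw * Pw" "T * q" "T * n" "Fw\<^sup>T" "T * q"] Fw Pw by simp
    also have "(Fw * Pw)\<^sup>T = Pw * Fw\<^sup>T" using transpose_mult[OF Fw Pw(1)] Pw(2) by simp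
    also have "Fw * (Pw * Fw\<^sup>T) = Fw * Pw * Fw\<^sup>T"
      by (rule assoc_mult_mat[symmetric, OF Fw Pw(1)]) (use Fw in simp)
    finally show ?thesis .
  qed
  then have Ssym: "(Fw * Pw * Fw\<^sup>T + Pv)\<^sup>T = Fw * Pw * Fw\<^sup>T + Pv"
    using transpose_add[OF FPF Pv(1)] Pv(2) by simp
  have Sc: "Fw * Pw * Fw\<^sup>T + Pv \<in> carrier_mat (T * q) (T * q)" using FPF Pv by simp
  have \<Sigma>sym: "\<Sigma>\<^sup>T = \<Sigma>"
  proof -
    have "\<Sigma>\<^sup>T = K * (K * (Fw * Pw * Fw\<^sup>T + Pv))\<^sup>T"
      unfolding \<Sigma>_eq using transpose_mult[of "K * (Fw * Pw * Fw\<^sup>T + Pv)" p "T * q" "K\<^sup>T" p] Kc Sc by simp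
    also have "(K * (Fw * Pw * Fw\<^sup>T + Pv))\<^sup>T = (Fw * Pw * Fw\<^sup>T + Pv) * K\<^sup>T"
      using transpose_mult[OF Kc Sc] Ssym by simp
    also have "K * ((Fw * Pw * Fw\<^sup>T + Pv) * K\<^sup>T) = \<Sigma>"
      unfolding \<Sigma>_eq by (rule assoc_mult_mat[symmetric, OF Kc Sc]) (use Kc in simp)
    finally show ?thesis .
  qed
  have cW: "W \<omega> \<in> carrier_vec (T * n)" and cV: "V \<omega> \<in> carrier_vec (T * q)" if "\<omega> \<in> space M" for \<omega>
    using measurable_space[OF W that] measurable_space[OF V that] by simp_all
  define \<mu> where "\<mu> = (K * Fa) *\<^sub>v U"
  define Z where "Z \<omega> = K *\<^sub>v (Fa *\<^sub>v U + (Fw *\<^sub>v W \<omega> + V \<omega>))" for \<omega>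
  have KFa: "K * Fa \<in> carrier_mat p (T * m)" using Kc Fa by simp
  have \<mu>: "\<mu> \<in> carrier_vec p" unfolding \<mu>_def using KFa U by (rule mult_mat_vec_carrier)
  have cZ: "Z \<omega> \<in> carrier_vec p" for \<omega> using Kc by (simp add: Z_def carrier_vecI)
  have FaU: "Fa *\<^sub>v U \<in> carrier_vec (T * q)" using Fa U by (rule mult_mat_vec_carrier)
  have linZ: "\<xi> \<bullet> Z \<omega> = \<xi> \<bullet> \<mu> + ((Fw\<^sup>T *\<^sub>v (K\<^sup>T *\<^sub>v \<xi>)) \<bullet> W \<omega> + (K\<^sup>T *\<^sub>v \<xi>) \<bullet> V \<omega>)"
    if \<xi>: "\<xi> \<in> carrier_vec p" and \<omega>: "\<omega> \<in> space M" for \<xi> \<omega>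
  proof -
    have b: "K\<^sup>T *\<^sub>v \<xi> \<in> carrier_vec (T * q)" using Kc \<xi> by auto
    have FW: "Fw *\<^sub>v W \<omega> \<in> carrier_vec (T * q)" using Fw cW[OF \<omega>] by (rule mult_mat_vec_carrier)
    have "\<xi> \<bullet> Z \<omega> = (K\<^sup>T *\<^sub>v \<xi>) \<bullet> (Fa *\<^sub>v U + (Fw *\<^sub>v W \<omega> + V \<omega>))"
      unfolding Z_def using transpose_vec_mult_scalar[OF Kc _ \<xi>] FaU FW cV[OF \<omega>] by simp
    also have "\<dots> = (K\<^sup>T *\<^sub>v \<xi>) \<bullet> (Fa *\<^sub>v U) + ((K\<^sup>T *\<^sub>v \<xi>) \<bullet> (Fw *\<^sub>v W \<omega>) + (K\<^sup>T *\<^sub>v \<xi>) \<bullet> V \<omega>)"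
      using b FaU FW cV[OF \<omega>] by (simp add: scalar_prod_add_distrib[of _ "T * q"])
    also have "(K\<^sup>T *\<^sub>v \<xi>) \<bullet> (Fa *\<^sub>v U) = \<xi> \<bullet> \<mu>"
      using transpose_vec_mult_scalar[OF Kc FaU \<xi>] assoc_mult_mat_vec[OF Kc Fa U] by (simp add: \<mu>_def)
    also have "(K\<^sup>T *\<^sub>v \<xi>) \<bullet> (Fw *\<^sub>v W \<omega>) = (Fw\<^sup>T *\<^sub>v (K\<^sup>T *\<^sub>v \<xi>)) \<bullet> W \<omega>"
      using transpose_vec_mult_scalar[OF Fw cW[OF \<omega>] b] by simp
    finally show ?thesis .
  qed
  have mZ: "Z \<in> measurable M (vec_borel p)"
  proof (rule measurable_vec_borelI[OF cZ])
    fix i assume i: "i < p"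
    let ?b = "K\<^sup>T *\<^sub>v unit_vec p i"
    have "Z \<omega> $ i = unit_vec p i \<bullet> \<mu> + ((Fw\<^sup>T *\<^sub>v ?b) \<bullet> W \<omega> + ?b \<bullet> V \<omega>)" if "\<omega> \<in> space M" for \<omega>
      using linZ[of "unit_vec p i", OF _ that] scalar_prod_left_unit[OF cZ i] by simp
    then show "(\<lambda>\<omega>. Z \<omega> $ i) \<in> borel_measurable M"
      using measurable_compose[OF W measurable_scalar_prod] measurable_compose[OF V measurable_scalar_prod]
      by (subst measurable_cong) auto
  qed
  have "prob {\<omega> \<in> space M. \<tau> \<le> Z \<omega> \<bullet> (inv_mat \<Sigma> *\<^sub>v Z \<omega>)} = Q \<tau> p (\<mu> \<bullet> (inv_mat \<Sigma> *\<^sub>v \<mu>))"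
  proof (rule prob_quadratic_form_ge[OF p mZ \<mu> \<Sigma> \<Sigma>sym])
    show "invertible_mat \<Sigma>" using inv by (simp add: \<Sigma>_def)
    fix \<xi> :: "real vec" assume \<xi>: "\<xi> \<in> carrier_vec p"
    define b where "b = K\<^sup>T *\<^sub>v \<xi>"
    define a where "a = Fw\<^sup>T *\<^sub>v b"
    have b: "b \<in> carrier_vec (T * q)" using Kc \<xi> by (auto simp: b_def)
    have a: "a \<in> carrier_vec (T * n)" using Fw b by (auto simp: a_def)
    have Pa: "Pw *\<^sub>v a \<in> carrier_vec (T * n)" using Pw(1) a by (rule mult_mat_vec_carrier)
    have Pb: "Pv *\<^sub>v b \<in> carrier_vec (T * q)" using Pv(1) b by (rule mult_mat_vec_carrier)
    have FPa: "Fw *\<^sub>v (Pw *\<^sub>v a) \<in> carrier_vec (T * q)" using Fw Pa by (rule mult_mat_vec_carrier)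
    have "\<Sigma> *\<^sub>v \<xi> = K *\<^sub>v ((Fw * Pw * Fw\<^sup>T + Pv) *\<^sub>v b)"
      unfolding \<Sigma>_eq b_def using Kc Sc \<xi>
      by (simp add: assoc_mult_mat_vec[of _ p "T * q" _ p] assoc_mult_mat_vec[of _ p "T * q" _ "T * q"])
    also have "(Fw * Pw * Fw\<^sup>T + Pv) *\<^sub>v b = Fw *\<^sub>v (Pw *\<^sub>v a) + Pv *\<^sub>v b"
      unfolding add_mult_distrib_mat_vec[OF FPF Pv(1) b] a_def using Fw Pw(1) b
      by (simp add: assoc_mult_mat_vec[of _ "T * q" "T * n" _ "T * q"] assoc_mult_mat_vec[of _ "T * q" "T * n" _ "T * n"])
    finally have "\<xi> \<bullet> (\<Sigma> *\<^sub>v \<xi>) = b \<bullet> (Fw *\<^sub>v (Pw *\<^sub>v a) + Pv *\<^sub>v b)"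
      using transpose_vec_mult_scalar[OF Kc _ \<xi>] FPa Pb by (simp add: b_def)
    also have "\<dots> = b \<bullet> (Fw *\<^sub>v (Pw *\<^sub>v a)) + b \<bullet> (Pv *\<^sub>v b)"
      by (rule scalar_prod_add_distrib[OF b FPa Pb])
    also have "b \<bullet> (Fw *\<^sub>v (Pw *\<^sub>v a)) = a \<bullet> (Pw *\<^sub>v a)"
      using transpose_vec_mult_scalar[OF Fw Pa b] by (simp add: a_def)
    finally have quad: "\<xi> \<bullet> (\<Sigma> *\<^sub>v \<xi>) = a \<bullet> (Pw *\<^sub>v a) + b \<bullet> (Pv *\<^sub>v b)" .
    have "(\<integral>\<omega>. iexp (\<xi> \<bullet> Z \<omega>) \<partial>M) = (\<integral>\<omega>. iexp (\<xi> \<bullet> \<mu>) * iexp (a \<bullet> W \<omega> + b \<bullet> V \<omega>) \<partial>M)"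
      using linZ[OF \<xi>] unfolding a_def b_def
      by (intro Bochner_Integration.integral_cong refl) (simp only: of_real_add distrib_left exp_add)
    also have "\<dots> = iexp (\<xi> \<bullet> \<mu>) * complex_of_real (exp (- (\<xi> \<bullet> (\<Sigma> *\<^sub>v \<xi>)) / 2))"
      by (simp only: integral_mult_right_zero ch[OF a b] quad Pw_def Pv_def)
    finally show "(\<integral>\<omega>. iexp (\<xi> \<bullet> Z \<omega>) \<partial>M) = iexp (\<xi> \<bullet> \<mu>) * complex_of_real (exp (- (\<xi> \<bullet> (\<Sigma> *\<^sub>v \<xi>)) / 2))" .
  qed
  moreover have "{\<omega> \<in> space M. \<tau> \<le> test_statistic T D K (Y \<omega>)} = {\<omega> \<in> space M. \<tau> \<le> Z \<omega> \<bullet> (inv_mat \<Sigma> *\<^sub>v Z \<omega>)}"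
    using Y by (auto simp: test_statistic_def \<Sigma>_def Z_def Fa_def Fw_def)
  moreover have "dof T D K = p"
    using invertible_mat_rank[OF \<Sigma>] inv by (simp add: dof_def \<Sigma>_def)
  moreover have "noncentrality T D K U = \<mu> \<bullet> (inv_mat \<Sigma> *\<^sub>v \<mu>)"
  proof -
    have I: "inv_mat \<Sigma> \<in> carrier_mat p p" using inv_mat_works(1)[OF \<Sigma>] inv by (simp add: \<Sigma>_def)
    have I\<mu>: "inv_mat \<Sigma> *\<^sub>v \<mu> \<in> carrier_vec p" using I \<mu> by (rule mult_mat_vec_carrier)
    have "sensitivity_mat T D K *\<^sub>v U = (K * Fa)\<^sup>T *\<^sub>v (inv_mat \<Sigma> *\<^sub>v \<mu>)"
      unfolding sensitivity_mat_def \<mu>_def Fa_def[symmetric] \<Sigma>_def[symmetric] using KFa I U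
      by (simp add: assoc_mult_mat_vec[of _ "T * m" p _ "T * m"] assoc_mult_mat_vec[of _ "T * m" p _ p]
        assoc_mult_mat_vec[OF KFa _ U] del: assoc_mult_mat)
    then have "noncentrality T D K U = U \<bullet> ((K * Fa)\<^sup>T *\<^sub>v (inv_mat \<Sigma> *\<^sub>v \<mu>))"
      by (simp add: noncentrality_def)
    also have "\<dots> = \<mu> \<bullet> (inv_mat \<Sigma> *\<^sub>v \<mu>)"
      using transpose_vec_mult_scalar[of "(K * Fa)\<^sup>T" "T * m" p "inv_mat \<Sigma> *\<^sub>v \<mu>" U] KFa U I\<mu> by (simp add: \<mu>_def)
    finally show ?thesis .
  qed
  ultimately show ?thesis by simp
qed

section \<open>Projected measurements of the interconnected system\<close>

text \<open>The lists \<open>[1..<T+1]\<close> and \<open>[1..<nsub S+1]\<close> are kept as they are: splitting off the last element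
  would destroy the block structure.\<close>

declare upt_Suc [simp del]

lemma vsum_remove:
  assumes f: "\<And>j. j \<in> set l \<Longrightarrow> f j \<in> carrier_vec n" and l: "distinct l" "i \<in> set l"
  shows "vsum n f l = f i + vsum n f (filter (\<lambda>j. j \<noteq> i) l)"
proof (intro eq_vecI)
  have c: "vsum n f l \<in> carrier_vec n" "vsum n f (filter (\<lambda>j. j \<noteq> i) l) \<in> carrier_vec n"
    using f by (auto intro!: vsum_carrier)
  then show "dim_vec (vsum n f l) = dim_vec (f i + vsum n f (filter (\<lambda>j. j \<noteq> i) l))" by simp
  fix r assume "r < dim_vec (f i + vsum n f (filter (\<lambda>j. j \<noteq> i) l))"
  then have r: "r < n" using c by simp
  have "vsum n f l $ r = (\<Sum>j\<in>set l. f j $ r)"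
    using f r l by (simp add: vsum_index sum_list_distinct_conv_sum_set)
  also have "\<dots> = f i $ r + (\<Sum>j\<in>set l - {i}. f j $ r)"
    using l by (simp add: sum.remove)
  also have "set l - {i} = set (filter (\<lambda>j. j \<noteq> i) l)" by auto
  also have "(\<Sum>j\<in>set (filter (\<lambda>j. j \<noteq> i) l). f j $ r) = vsum n f (filter (\<lambda>j. j \<noteq> i) l) $ r"
    using f r l by (subst vsum_index) (auto simp: sum_list_distinct_conv_sum_set)
  also have "f i $ r + \<dots> = (f i + vsum n f (filter (\<lambda>j. j \<noteq> i) l)) $ r"
    using c r by simp
  finally show "vsum n f l $ r = (f i + vsum n f (filter (\<lambda>j. j \<noteq> i) l)) $ r" .
qed

lemma state_carrier:
  assumes S: "well_formed S" and a: "admissible_attack S a"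
    and w: "\<And>i k. i \<in> {1..nsub S} \<Longrightarrow> w i k \<in> carrier_vec (sdim S i)" and i: "i \<in> {1..nsub S}"
  shows "state S a w k i \<in> carrier_vec (sdim S i)"
proof (cases k)
  case 0
  then show ?thesis using S i by (simp add: well_formed_def)
next
  case (Suc k')
  then have "dim_vec (state S a w k i) = dim_vec (w i k')" by simp
  then show ?thesis using w[OF i, of k'] by (metis carrier_vecD carrier_vecI)
qed

lemma coupling_mat_carrier:
  assumes S: "well_formed S" and i: "i \<in> {1..nsub S}"
  shows "coupling_mat S i \<in> carrier_mat (sdim S i) (\<Sum>j\<leftarrow>others S i. sdim S j)"
  unfolding coupling_mat_def by (rule stack_cols_carrier) (use S i in \<open>auto simp: well_formed_def\<close>)

text \<open>The local detector treats the states of the other subsystems as an arbitrary unknown input. These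
  states are random and correlated with the local noise, but they enter only through \<open>\<F>\<^sup>(\<^sup>u\<^sup>)\<close>, so the
  projection removes them for every single realization of the noise.\<close>

lemma local_meas_residual:
  assumes S: "well_formed S" and a: "admissible_attack S a"
    and w: "\<And>i k. i \<in> {1..nsub S} \<Longrightarrow> w i k \<in> carrier_vec (sdim S i)"
    and v: "\<And>i k. i \<in> {1..nsub S} \<Longrightarrow> v i k \<in> carrier_vec (odim S i)"
    and i: "i \<in> {1..nsub S}" and K: "rows_basis_left_null K (local_nuisance S T i)"
  shows "K *\<^sub>v local_meas S T i a w v = K *\<^sub>v (attack_response T (local_model S i) *\<^sub>v local_attack T i a
    + (noise_response T (local_model S i) *\<^sub>v stack_vecs (map (w i) [0..<T]) + stack_vecs (map (v i) [1..<T+1])))"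
proof -
  let ?D = "local_model S i" and ?n = "sdim S i" and ?q = "odim S i" and ?B = "coupling_mat S i"
  let ?m = "\<Sum>j\<leftarrow>others S i. sdim S j"
  define x where "x k = state S a w k i" for k
  define s where "s k = stack_vecs (map (state S a w k) (others S i))" for k
  note xc = state_carrier[of S a w, OF S a w]
  have A: "dynm ?D \<in> carrier_mat ?n ?n" and C: "outm ?D \<in> carrier_mat ?q ?n" and Ba: "attm ?D \<in> carrier_mat ?n (adim S i)"
    using S i by (auto simp: well_formed_def local_model_def)
  have B: "?B \<in> carrier_mat ?n ?m" by (rule coupling_mat_carrier[OF S i])
  have x: "x k \<in> carrier_vec ?n" for k using xc i by (simp add: x_def)
  have s: "s k \<in> carrier_vec ?m" for k unfolding s_def by (rule stack_vecs_carrier) (use xc in auto)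
  have ac: "a i k \<in> carrier_vec (adim S i)" for k using a i by (simp add: admissible_attack_def)
  have Bs: "?B *\<^sub>v s k \<in> carrier_vec ?n" and Baa: "attm ?D *\<^sub>v a i k \<in> carrier_vec ?n" for k
    using mult_mat_vec_carrier[OF B s] mult_mat_vec_carrier[OF Ba ac] by auto
  let ?f = "\<lambda>k. ?B *\<^sub>v s k + (attm ?D *\<^sub>v a i k + w i k)"
  let ?O = "obs_mat T ?D" and ?Fu = "input_response T ?D ?B" and ?Fa = "attack_response T ?D" and ?Fw = "noise_response T ?D"
  have O: "?O \<in> carrier_mat (T * ?q) ?n" by (rule obs_mat_carrier[OF A C])
  have Fu: "?Fu \<in> carrier_mat (T * ?q) (T * ?m)" by (rule input_response_carrier[OF A C B])
  have Fa: "?Fa \<in> carrier_mat (T * ?q) (T * adim S i)" by (rule input_response_carrier[OF A C Ba])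
  have Fw: "?Fw \<in> carrier_mat (T * ?q) (T * ?n)" by (rule noise_response_carrier[OF A C])
  have stk: "stack_vecs (map g [0..<T]) \<in> carrier_vec (T * c)" if "\<And>k. g k \<in> carrier_vec c" for g :: "nat \<Rightarrow> real vec" and c
    using stack_vecs_carrier[of "[0..<T]" g "\<lambda>_. c"] that by (simp add: sum_list_triv)
  have step: "x (Suc k) = dynm ?D *\<^sub>v x k + ?f k" for k
  proof -
    have "dynm ?D *\<^sub>v x k \<in> carrier_vec ?n" using A x by (rule mult_mat_vec_carrier)
    then show ?thesis
      using Bs[of k] Baa[of k] w[OF i, of k]
      by (simp add: x_def s_def local_model_def assoc_add_vec[of _ ?n])
  qed
  have meas: "local_meas S T i a w v = stack_vecs (map (\<lambda>k. outm ?D *\<^sub>v x k + v i k) [1..<T+1])"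
    by (simp add: local_meas_def meas_def x_def local_model_def)
  have "local_meas S T i a w v = ?O *\<^sub>v x 0 + (?Fw *\<^sub>v stack_vecs (map ?f [0..<T]) + stack_vecs (map (v i) [1..<T+1]))"
    unfolding meas by (rule stacked_output[where x = x and f = ?f and e = "v i", OF A C x _ _ step]) (use Bs Baa w v i in auto)
  also have "stack_vecs (map ?f [0..<T]) = stack_vecs (map (\<lambda>k. ?B *\<^sub>v s k) [0..<T])
      + (stack_vecs (map (\<lambda>k. attm ?D *\<^sub>v a i k) [0..<T]) + stack_vecs (map (w i) [0..<T]))"
    using Bs Baa w i by (subst stack_vecs_add[where n = "\<lambda>_. ?n"], simp, subst stack_vecs_add[where n = "\<lambda>_. ?n"]) auto
  also have "?Fw *\<^sub>v \<dots> = ?Fw *\<^sub>v stack_vecs (map (\<lambda>k. ?B *\<^sub>v s k) [0..<T])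
      + (?Fw *\<^sub>v stack_vecs (map (\<lambda>k. attm ?D *\<^sub>v a i k) [0..<T]) + ?Fw *\<^sub>v stack_vecs (map (w i) [0..<T]))"
    using stk[OF Bs] stk[OF Baa] stk[OF w[OF i]]
    by (simp add: mult_add_distrib_mat_vec[OF Fw])
  also have "?Fw *\<^sub>v stack_vecs (map (\<lambda>k. ?B *\<^sub>v s k) [0..<T]) = ?Fu *\<^sub>v stack_vecs (map s [0..<T])"
    by (rule input_response_mult_stack_vecs[OF A C B s, symmetric])
  also have "?Fw *\<^sub>v stack_vecs (map (\<lambda>k. attm ?D *\<^sub>v a i k) [0..<T]) = ?Fa *\<^sub>v local_attack T i a"
    unfolding local_attack_def by (rule input_response_mult_stack_vecs[OF A C Ba ac, symmetric])
  finally have Y: "local_meas S T i a w v = ?O *\<^sub>v x 0 + (?Fu *\<^sub>v stack_vecs (map s [0..<T])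
      + (?Fa *\<^sub>v local_attack T i a + ?Fw *\<^sub>v stack_vecs (map (w i) [0..<T])) + stack_vecs (map (v i) [1..<T+1]))" .
  have sc: "stack_vecs (map s [0..<T]) \<in> carrier_vec (T * ?m)" using stk[OF s] by simp
  have 1: "?O *\<^sub>v x 0 \<in> carrier_vec (T * ?q)" using O x by (rule mult_mat_vec_carrier)
  have 2: "?Fu *\<^sub>v stack_vecs (map s [0..<T]) \<in> carrier_vec (T * ?q)" using Fu sc by (rule mult_mat_vec_carrier)
  have 3: "?Fa *\<^sub>v local_attack T i a \<in> carrier_vec (T * ?q)"
    using stk[OF ac] by (intro mult_mat_vec_carrier[OF Fa]) (simp add: local_attack_def)
  have 4: "?Fw *\<^sub>v stack_vecs (map (w i) [0..<T]) \<in> carrier_vec (T * ?q)"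
    using stk[OF w[OF i]] by (intro mult_mat_vec_carrier[OF Fw]) simp
  have 5: "stack_vecs (map (v i) [1..<T+1]) \<in> carrier_vec (T * ?q)" 
    using stack_vecs_carrier[of "[1..<T+1]" "v i" "\<lambda>_. ?q"] v[OF i] by (simp add: sum_list_triv)
  define z where "z = stack_vecs [x 0, stack_vecs (map s [0..<T])]"
  have N: "local_nuisance S T i \<in> carrier_mat (T * ?q) (?n + T * ?m)"
    and z: "z \<in> carrier_vec (?n + T * ?m)"
    and Nz: "local_nuisance S T i *\<^sub>v z = ?O *\<^sub>v x 0 + ?Fu *\<^sub>v stack_vecs (map s [0..<T])"
  proof -
    let ?F = "\<lambda>b. if b then ?O else ?Fu" and ?y = "\<lambda>b. if b then x 0 else stack_vecs (map s [0..<T])"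
    let ?k = "\<lambda>b. if b then ?n else T * ?m"
    have Fy: "?F b \<in> carrier_mat (T * ?q) (?k b) \<and> ?y b \<in> carrier_vec (?k b)" for b using O Fu x sc by auto
    have N: "local_nuisance S T i = stack_cols (T * ?q) (map ?F [True, False])" by (simp add: local_nuisance_def)
    have z: "z = stack_vecs (map ?y [True, False])" by (simp add: z_def)
    show "z \<in> carrier_vec (?n + T * ?m)"
      using stack_vecs_carrier[of "[True, False]" ?y ?k] Fy unfolding z by simp
    show "local_nuisance S T i \<in> carrier_mat (T * ?q) (?n + T * ?m)"
      using stack_cols_carrier[of "[True, False]" ?F "T * ?q" ?k] Fy unfolding N by simp
    show "local_nuisance S T i *\<^sub>v z = ?O *\<^sub>v x 0 + ?Fu *\<^sub>v stack_vecs (map s [0..<T])"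
      unfolding N z using 2 by (subst stack_cols_mult_stack_vecs[where n = ?k]) (use Fy in auto)
  qed
  have Kc: "K \<in> carrier_mat (dim_row K) (T * ?q)" using K N by (auto simp: rows_basis_left_null_def)
  let ?R = "?Fa *\<^sub>v local_attack T i a + (?Fw *\<^sub>v stack_vecs (map (w i) [0..<T]) + stack_vecs (map (v i) [1..<T+1]))"
  have R: "?R \<in> carrier_vec (T * ?q)" using 3 4 5 by (intro add_carrier_vec)
  have "local_meas S T i a w v = local_nuisance S T i *\<^sub>v z + ?R"
    unfolding Y Nz using 1 2 3 4 5 by (simp add: assoc_add_vec[of _ "T * ?q"])
  also have "K *\<^sub>v \<dots> = K *\<^sub>v (local_nuisance S T i *\<^sub>v z) + K *\<^sub>v ?R"
    by (rule mult_add_distrib_mat_vec[OF Kc mult_mat_vec_carrier[OF N z] R])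
  also have "K *\<^sub>v (local_nuisance S T i *\<^sub>v z) = 0\<^sub>v (dim_row K)"
    using N z by (intro basis_rows_annihilate[OF K]) simp
  also have "0\<^sub>v (dim_row K) + K *\<^sub>v ?R = K *\<^sub>v ?R"
    by (rule left_zero_vec[OF mult_mat_vec_carrier[OF Kc R]])
  finally show ?thesis .
qed

text \<open>For the stacked system the interconnection is part of the dynamics, and the initial state is the only
  nuisance.\<close>

lemma central_meas_residual:
  assumes S: "well_formed S" and a: "admissible_attack S a"
    and w: "\<And>i k. i \<in> {1..nsub S} \<Longrightarrow> w i k \<in> carrier_vec (sdim S i)"
    and v: "\<And>i k. i \<in> {1..nsub S} \<Longrightarrow> v i k \<in> carrier_vec (odim S i)"
    and K: "rows_basis_left_null K (central_nuisance S T)"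
  shows "K *\<^sub>v central_meas S T a w v = K *\<^sub>v (attack_response T (central_model S) *\<^sub>v central_attack S T a
    + (noise_response T (central_model S) *\<^sub>v stack_vecs (map (\<lambda>k. stack_vecs (map (\<lambda>i. w i k) (subsystems S))) [0..<T])
       + stack_vecs (map (\<lambda>k. stack_vecs (map (\<lambda>i. v i k) (subsystems S))) [1..<T+1])))"
proof -
  define l where "l = subsystems S"
  let ?D = "central_model S"
  let ?n = "\<Sum>i\<leftarrow>l. sdim S i" and ?q = "\<Sum>i\<leftarrow>l. odim S i" and ?m = "\<Sum>i\<leftarrow>l. adim S i"
  have l: "set l = {1..nsub S}" "distinct l" by (auto simp: l_def)
  have others: "others S i = filter (\<lambda>j. j \<noteq> i) l" for i by (simp add: l_def)
  have xc: "state S a w k i \<in> carrier_vec (sdim S i)" if "i \<in> set l" for k i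
    using state_carrier[of S a w, OF S a w] that l by blast
  have w: "w i k \<in> carrier_vec (sdim S i)" and v: "v i k \<in> carrier_vec (odim S i)" if "i \<in> set l" for i k
    using w v that l(1) by auto
  define x where "x k = stack_vecs (map (state S a w k) l)" for k
  define u where "u k = stack_vecs (map (\<lambda>i. a i k) l)" for k
  define ws where "ws k = stack_vecs (map (\<lambda>i. w i k) l)" for k
  define vs where "vs k = stack_vecs (map (\<lambda>i. v i k) l)" for k
  have ac: "a i k \<in> carrier_vec (adim S i)" if "i \<in> set l" for i k
    using a that l(1) by (simp add: admissible_attack_def)
  have Aij: "Amat S i j \<in> carrier_mat (sdim S i) (sdim S j)" and Ci: "Cmat S i \<in> carrier_mat (odim S i) (sdim S i)"
    and Bi: "Bamat S i \<in> carrier_mat (sdim S i) (adim S i)"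
    if "i \<in> set l" "j \<in> set l" for i j
    using S that l(1) by (auto simp: well_formed_def)
  have A: "dynm ?D \<in> carrier_mat ?n ?n"
    unfolding central_model_def detector_model.simps l_def[symmetric] by (rule block_mat_carrier) (use Aij in blast)
  have C: "outm ?D \<in> carrier_mat ?q ?n"
    unfolding central_model_def detector_model.simps l_def[symmetric] by (rule diag_block_mat_carrier) (use Ci in blast)
  have Ba: "attm ?D \<in> carrier_mat ?n ?m"
    unfolding central_model_def detector_model.simps l_def[symmetric] by (rule diag_block_mat_carrier) (use Bi in blast)
  have x: "x k \<in> carrier_vec ?n" and u: "u k \<in> carrier_vec ?m" and ws: "ws k \<in> carrier_vec ?n" and vs: "vs k \<in> carrier_vec ?q" for k
    unfolding x_def u_def ws_def vs_def using xc ac w v by (intro stack_vecs_carrier; blast)+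
  have Bu: "attm ?D *\<^sub>v u k \<in> carrier_vec ?n" for k using Ba u by (rule mult_mat_vec_carrier)
  let ?f = "\<lambda>k. attm ?D *\<^sub>v u k + ws k"
  have step: "x (Suc k) = dynm ?D *\<^sub>v x k + ?f k" for k
  proof -
    let ?r = "\<lambda>i. vsum (sdim S i) (\<lambda>j. Amat S i j *\<^sub>v state S a w k j) l"
    have Ax: "Amat S i j *\<^sub>v state S a w k j \<in> carrier_vec (sdim S i)" if "i \<in> set l" "j \<in> set l" for i j
      using Aij xc that by (auto intro!: mult_mat_vec_carrier)
    have r: "?r i \<in> carrier_vec (sdim S i)" if "i \<in> set l" for i
      using Ax that by (intro vsum_carrier)
    have Bac: "Bamat S i *\<^sub>v a i k \<in> carrier_vec (sdim S i)" if "i \<in> set l" for i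
      using Bi ac that by (auto intro!: mult_mat_vec_carrier)
    have "dynm ?D *\<^sub>v x k = stack_vecs (map ?r l)"
      unfolding central_model_def detector_model.simps l_def[symmetric] x_def
      by (rule block_mat_mult_stack_vecs) (use Aij xc in blast)+
    moreover have "attm ?D *\<^sub>v u k = stack_vecs (map (\<lambda>i. Bamat S i *\<^sub>v a i k) l)"
      unfolding central_model_def detector_model.simps l_def[symmetric] u_def
      by (rule diag_block_mat_mult_stack_vecs[where n = "adim S"]) (use Bi ac in blast)
    moreover have "stack_vecs (map ?r l) + (stack_vecs (map (\<lambda>i. Bamat S i *\<^sub>v a i k) l) + ws k)
        = stack_vecs (map (\<lambda>i. ?r i + (Bamat S i *\<^sub>v a i k + w i k)) l)"
    proof -
      have "stack_vecs (map (\<lambda>i. Bamat S i *\<^sub>v a i k) l) + ws k = stack_vecs (map (\<lambda>i. Bamat S i *\<^sub>v a i k + w i k) l)"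
        unfolding ws_def by (rule stack_vecs_add[where n = "sdim S"]) (use Bac w in blast)
      moreover have "stack_vecs (map ?r l) + \<dots> = stack_vecs (map (\<lambda>i. ?r i + (Bamat S i *\<^sub>v a i k + w i k)) l)"
        by (rule stack_vecs_add[where n = "sdim S"]) (use r Bac w add_carrier_vec in blast)
      ultimately show ?thesis by simp
    qed
    moreover have "state S a w (Suc k) i = ?r i + (Bamat S i *\<^sub>v a i k + w i k)" if i: "i \<in> set l" for i
    proof -
      have "coupling_mat S i *\<^sub>v stack_vecs (map (state S a w k) (others S i))
          = vsum (sdim S i) (\<lambda>j. Amat S i j *\<^sub>v state S a w k j) (filter (\<lambda>j. j \<noteq> i) l)" (is "_ = ?o")
        unfolding coupling_mat_def others
        by (rule stack_cols_mult_stack_vecs[where n = "sdim S"]) (use Aij xc i in auto)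
      moreover have "?r i = Amat S i i *\<^sub>v state S a w k i + ?o"
        using Ax[OF i] i l(2) by (intro vsum_remove) auto
      moreover have "?o \<in> carrier_vec (sdim S i)" using Ax[OF i] by (intro vsum_carrier) auto
      ultimately show ?thesis
        using Ax[OF i i] Bac[OF i] w[of i k] i by (simp add: assoc_add_vec[of _ "sdim S i"])
    qed
    ultimately show ?thesis by (simp add: x_def cong: map_cong)
  qed
  have "central_meas S T a w v = stack_vecs (map (\<lambda>k. outm ?D *\<^sub>v x k + vs k) [1..<T+1])"
  proof -
    have "stack_vecs (map (meas S a w v k) l) = outm ?D *\<^sub>v x k + vs k" for k
    proof -
      have "outm ?D *\<^sub>v x k = stack_vecs (map (\<lambda>i. Cmat S i *\<^sub>v state S a w k i) l)"
        unfolding central_model_def detector_model.simps l_def[symmetric] x_def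
        by (rule diag_block_mat_mult_stack_vecs[where n = "sdim S"]) (use Ci xc in blast)
      moreover have "\<dots> + vs k = stack_vecs (map (\<lambda>i. Cmat S i *\<^sub>v state S a w k i + v i k) l)"
        unfolding vs_def by (rule stack_vecs_add[where n = "odim S"]) (use Ci xc v mult_mat_vec_carrier in blast)
      moreover have "meas S a w v k = (\<lambda>i. Cmat S i *\<^sub>v state S a w k i + v i k)"
        by (simp add: fun_eq_iff meas_def)
      ultimately show ?thesis by simp
    qed
    then show ?thesis by (simp add: central_meas_def l_def)
  qed
  also have "\<dots> = obs_mat T ?D *\<^sub>v x 0 + (noise_response T ?D *\<^sub>v stack_vecs (map ?f [0..<T]) + stack_vecs (map vs [1..<T+1]))"
    by (rule stacked_output[where x = x and f = ?f and e = vs, OF A C x _ vs step]) (use Bu ws in auto)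
  also have "stack_vecs (map ?f [0..<T]) = stack_vecs (map (\<lambda>k. attm ?D *\<^sub>v u k) [0..<T]) + stack_vecs (map ws [0..<T])"
    using Bu ws by (subst stack_vecs_add[where n = "\<lambda>_. ?n"]) auto
  also have "noise_response T ?D *\<^sub>v \<dots> = noise_response T ?D *\<^sub>v stack_vecs (map (\<lambda>k. attm ?D *\<^sub>v u k) [0..<T])
      + noise_response T ?D *\<^sub>v stack_vecs (map ws [0..<T])"
    using stack_vecs_carrier[of "[0..<T]" "\<lambda>k. attm ?D *\<^sub>v u k" "\<lambda>_. ?n"] stack_vecs_carrier[of "[0..<T]" ws "\<lambda>_. ?n"] Bu ws
    by (intro mult_add_distrib_mat_vec[OF noise_response_carrier[OF A C]]) (simp_all add: sum_list_triv)
  also have "noise_response T ?D *\<^sub>v stack_vecs (map (\<lambda>k. attm ?D *\<^sub>v u k) [0..<T]) = attack_response T ?D *\<^sub>v central_attack S T a"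
    unfolding central_attack_def l_def[symmetric] u_def[symmetric]
    by (rule input_response_mult_stack_vecs[OF A C Ba u, symmetric])
  finally have Y: "central_meas S T a w v = obs_mat T ?D *\<^sub>v x 0 + (attack_response T ?D *\<^sub>v central_attack S T a
      + noise_response T ?D *\<^sub>v stack_vecs (map ws [0..<T]) + stack_vecs (map vs [1..<T+1]))" .
  have O: "obs_mat T ?D \<in> carrier_mat (T * ?q) ?n" by (rule obs_mat_carrier[OF A C])
  have 1: "obs_mat T ?D *\<^sub>v x 0 \<in> carrier_vec (T * ?q)" using O x by (rule mult_mat_vec_carrier)
  have 2: "attack_response T ?D *\<^sub>v central_attack S T a \<in> carrier_vec (T * ?q)"
    using stack_vecs_carrier[of "[0..<T]" u "\<lambda>_. ?m"] u unfolding central_attack_def l_def[symmetric] u_def[symmetric]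
    by (intro mult_mat_vec_carrier[OF input_response_carrier[OF A C Ba]]) (simp add: sum_list_triv)
  have 3: "noise_response T ?D *\<^sub>v stack_vecs (map ws [0..<T]) \<in> carrier_vec (T * ?q)"
    using stack_vecs_carrier[of "[0..<T]" ws "\<lambda>_. ?n"] ws
    by (intro mult_mat_vec_carrier[OF noise_response_carrier[OF A C]]) (simp add: sum_list_triv)
  have 4: "stack_vecs (map vs [1..<T+1]) \<in> carrier_vec (T * ?q)"
    using stack_vecs_carrier[of "[1..<T+1]" vs "\<lambda>_. ?q"] vs by (simp add: sum_list_triv del: upt_Suc)
  have Kc: "K \<in> carrier_mat (dim_row K) (T * ?q)" using K O by (auto simp: rows_basis_left_null_def central_nuisance_def)
  let ?R = "attack_response T ?D *\<^sub>v central_attack S T a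
      + (noise_response T ?D *\<^sub>v stack_vecs (map ws [0..<T]) + stack_vecs (map vs [1..<T+1]))"
  have R: "?R \<in> carrier_vec (T * ?q)" using 2 3 4 by (intro add_carrier_vec)
  have "central_meas S T a w v = obs_mat T ?D *\<^sub>v x 0 + ?R"
    unfolding Y using 1 2 3 4 by (simp add: assoc_add_vec[of _ "T * ?q"])
  also have "K *\<^sub>v \<dots> = K *\<^sub>v (obs_mat T ?D *\<^sub>v x 0) + K *\<^sub>v ?R"
    by (rule mult_add_distrib_mat_vec[OF Kc 1 R])
  also have "K *\<^sub>v (obs_mat T ?D *\<^sub>v x 0) = 0\<^sub>v (dim_row K)"
    using basis_rows_annihilate[OF K, of "x 0"] O x by (simp add: central_nuisance_def)
  also have "0\<^sub>v (dim_row K) + K *\<^sub>v ?R = K *\<^sub>v ?R"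
    by (rule left_zero_vec[OF mult_mat_vec_carrier[OF Kc R]])
  also have "ws = (\<lambda>k. stack_vecs (map (\<lambda>i. w i k) l))" by (simp add: fun_eq_iff ws_def)
  also have "vs = (\<lambda>k. stack_vecs (map (\<lambda>i. v i k) l))" by (simp add: fun_eq_iff vs_def)
  finally show ?thesis by (simp only: l_def)
qed

section \<open>Alarm probabilities of the local and centralized tests\<close>

lemma measurable_stack_vecs:
  assumes "\<And>i. i \<in> set l \<Longrightarrow> f i \<in> measurable M (vec_borel (n i))"
  shows "(\<lambda>\<omega>. stack_vecs (map (\<lambda>i. f i \<omega>) l)) \<in> measurable M (vec_borel (\<Sum>i\<leftarrow>l. n i))"
  using assms
proof (induction l)
  case Nil
  show ?case by (rule measurable_vec_borelI) auto
next
  case (Cons i l)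
  let ?g = "\<lambda>\<omega>. stack_vecs (map (\<lambda>i. f i \<omega>) l)" and ?N = "\<Sum>i\<leftarrow>l. n i"
  have f: "f i \<in> measurable M (vec_borel (n i))" and g: "?g \<in> measurable M (vec_borel ?N)"
    using Cons by auto
  have c: "f i \<omega> \<in> carrier_vec (n i)" "?g \<omega> \<in> carrier_vec ?N" if "\<omega> \<in> space M" for \<omega>
    using measurable_space[OF f that] measurable_space[OF g that] by simp_all
  have "(\<lambda>\<omega>. f i \<omega> @\<^sub>v ?g \<omega>) \<in> measurable M (vec_borel (n i + ?N))"
  proof (rule measurable_vec_borelI)
    fix r assume r: "r < n i + ?N"
    have "(f i \<omega> @\<^sub>v ?g \<omega>) $ r = (if r < n i then f i \<omega> $ r else ?g \<omega> $ (r - n i))" if "\<omega> \<in> space M" for \<omega>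
      using c[OF that, THEN carrier_vecD] r by (subst index_append_vec) simp_all
    moreover have "(\<lambda>\<omega>. if r < n i then f i \<omega> $ r else ?g \<omega> $ (r - n i)) \<in> borel_measurable M"
      using measurable_compose[OF f measurable_vec_borel_component] measurable_compose[OF g measurable_vec_borel_component] r
      by (cases "r < n i") auto
    ultimately show "(\<lambda>\<omega>. (f i \<omega> @\<^sub>v ?g \<omega>) $ r) \<in> borel_measurable M"
      by (subst measurable_cong)
  qed (use c in auto)
  then show ?case by simp
qed

lemma stack_vecs_zero: "stack_vecs (map (\<lambda>i. 0\<^sub>v (n i)) l) = 0\<^sub>v (\<Sum>i\<leftarrow>l. n i)"
  by (induction l) (auto intro!: eq_vecI)

lemma noncentrality_zero: "noncentrality T D K (0\<^sub>v N) = 0"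
proof -
  have "sensitivity_mat T D K *\<^sub>v 0\<^sub>v N = 0\<^sub>v (dim_row (sensitivity_mat T D K))"
    by (intro eq_vecI) (auto simp: scalar_prod_def)
  then show ?thesis by (simp add: noncentrality_def scalar_prod_def)
qed

lemma diag_block_mat_symmetric:
  assumes "\<And>i. i \<in> set l \<Longrightarrow> F i \<in> carrier_mat (n i) (n i) \<and> (F i)\<^sup>T = F i"
  shows "(diag_block_mat (map F l))\<^sup>T = diag_block_mat (map F l)"
  using assms
proof (induction l)
  case Nil
  show ?case by auto
next
  case (Cons i l)
  have F: "F i \<in> carrier_mat (n i) (n i)" "(F i)\<^sup>T = F i" using Cons.prems by auto
  have D: "diag_block_mat (map F l) \<in> carrier_mat (\<Sum>i\<leftarrow>l. n i) (\<Sum>i\<leftarrow>l. n i)"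
    using Cons.prems by (intro diag_block_mat_carrier) auto
  have "(diag_block_mat (map F l))\<^sup>T = diag_block_mat (map F l)" using Cons by auto
  then show ?case
    using transpose_four_block_mat[OF F(1) zero_carrier_mat zero_carrier_mat D] F D by (simp add: Let_def)
qed

lemma gaussian_noiseD:
  assumes "gaussian_noise M S w v" and "i \<in> {1..nsub S}"
  shows "w i k \<in> measurable M (vec_borel (sdim S i))" "v i k \<in> measurable M (vec_borel (odim S i))"
    and "covw S i \<in> carrier_mat (sdim S i) (sdim S i)" "(covw S i)\<^sup>T = covw S i"
    and "covv S i \<in> carrier_mat (odim S i) (odim S i)" "(covv S i)\<^sup>T = covv S i"
proof -
  have g: "gaussian_vec M (sdim S i) (w i k) (0\<^sub>v (sdim S i)) (covw S i)"
    "gaussian_vec M (odim S i) (v i k) (0\<^sub>v (odim S i)) (covv S i)" for k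
    using assms unfolding gaussian_noise_def by auto
  show "w i k \<in> measurable M (vec_borel (sdim S i))" "v i k \<in> measurable M (vec_borel (odim S i))"
    using g unfolding gaussian_vec_def by blast+
  show "covw S i \<in> carrier_mat (sdim S i) (sdim S i)" "(covw S i)\<^sup>T = covw S i"
    "covv S i \<in> carrier_mat (odim S i) (odim S i)" "(covv S i)\<^sup>T = covv S i"
    using gaussian_vec_cov[OF g(1)] gaussian_vec_cov[OF g(2)] by auto
qed

lemma (in prob_space) local_alarm_prob_eq:
  assumes S: "well_formed S" and noise: "gaussian_noise M S w v" and a: "admissible_attack S a"
    and i: "i \<in> {1..nsub S}"
    and ne: "left_null_space (local_nuisance S T i) \<noteq> {0\<^sub>v (T * odim S i)}"
    and K: "rows_basis_left_null K (local_nuisance S T i)"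
    and inv: "invertible_mat (test_cov T (local_model S i) K)"
  shows "local_alarm_prob M S w v T i K \<tau> a
    = Q \<tau> (dof T (local_model S i) K) (noncentrality T (local_model S i) K (local_attack T i a))"
proof -
  let ?D = "local_model S i"
  define W where "W \<omega> = stack_vecs (map (\<lambda>k. w i k \<omega>) [0..<T])" for \<omega>
  define V where "V \<omega> = stack_vecs (map (\<lambda>k. v i k \<omega>) [1..<T+1])" for \<omega>
  note gn = gaussian_noiseD[OF noise]
  have c: "w j k \<omega> \<in> carrier_vec (sdim S j)" "v j k \<omega> \<in> carrier_vec (odim S j)"
    if "j \<in> {1..nsub S}" "\<omega> \<in> space M" for j k \<omega>
    using measurable_space[OF gn(1) that(2)] measurable_space[OF gn(2) that(2)] that(1) by simp_all
  have D: "dynm ?D \<in> carrier_mat (sdim S i) (sdim S i)" "attm ?D \<in> carrier_mat (sdim S i) (adim S i)"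
    "outm ?D \<in> carrier_mat (odim S i) (sdim S i)"
    "pcov ?D \<in> carrier_mat (sdim S i) (sdim S i)" "(pcov ?D)\<^sup>T = pcov ?D"
    "mcov ?D \<in> carrier_mat (odim S i) (odim S i)" "(mcov ?D)\<^sup>T = mcov ?D"
    using S i gn(3-6)[OF i] by (auto simp: well_formed_def local_model_def)
  have dim: "dim_row (local_nuisance S T i) = T * odim S i" by (simp add: local_nuisance_def stack_cols_def)
  have U: "local_attack T i a \<in> carrier_vec (T * adim S i)"
    using stack_vecs_carrier[of "[0..<T]" "a i" "\<lambda>_. adim S i"] a i
    by (simp add: local_attack_def admissible_attack_def sum_list_triv)
  have W: "W \<in> measurable M (vec_borel (T * sdim S i))"
    using measurable_stack_vecs[of "[0..<T]" "w i" M "\<lambda>_. sdim S i"] gn(1)[OF i]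
    by (simp add: W_def[abs_def] sum_list_triv)
  have V: "V \<in> measurable M (vec_borel (T * odim S i))"
    using measurable_stack_vecs[of "[1..<T+1]" "v i" M "\<lambda>_. odim S i"] gn(2)[OF i]
    by (simp add: V_def[abs_def] sum_list_triv)
  have "\<P>(\<omega> in M. test_statistic T ?D K (local_meas S T i a (\<lambda>j k. w j k \<omega>) (\<lambda>j k. v j k \<omega>)) \<ge> \<tau>)
      = Q \<tau> (dof T ?D K) (noncentrality T ?D K (local_attack T i a))"
  proof (rule alarm_prob[OF D K dim _ inv U W V])
    show "left_null_space (local_nuisance S T i) \<noteq> {0\<^sub>v (dim_row (local_nuisance S T i))}"
      using ne by (simp add: dim)
    show "(\<integral>\<omega>. iexp (x \<bullet> W \<omega> + y \<bullet> V \<omega>) \<partial>M)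
        = complex_of_real (exp (- (x \<bullet> (kronecker (1\<^sub>m T) (pcov ?D) *\<^sub>v x) + y \<bullet> (kronecker (1\<^sub>m T) (mcov ?D) *\<^sub>v y)) / 2))"
      if "x \<in> carrier_vec (T * sdim S i)" "y \<in> carrier_vec (T * odim S i)" for x y
      using stacked_noise_char[OF noise, of "[i]" x T y] that i
      by (simp only: list.map stack_vecs_singleton diag_block_mat_singleton W_def V_def local_model_def detector_model.simps) simp
    show "K *\<^sub>v local_meas S T i a (\<lambda>j k. w j k \<omega>) (\<lambda>j k. v j k \<omega>)
        = K *\<^sub>v (attack_response T ?D *\<^sub>v local_attack T i a + (noise_response T ?D *\<^sub>v W \<omega> + V \<omega>))"
      if "\<omega> \<in> space M" for \<omega>
      unfolding W_def V_def by (rule local_meas_residual[OF S a _ _ i K]) (use c that in auto)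
  qed
  then show ?thesis by (simp add: local_alarm_prob_def)
qed

lemma (in prob_space) central_alarm_prob_eq:
  assumes S: "well_formed S" and noise: "gaussian_noise M S w v" and a: "admissible_attack S a"
    and ne: "left_null_space (central_nuisance S T) \<noteq> {0\<^sub>v (dim_row (central_nuisance S T))}"
    and K: "rows_basis_left_null K (central_nuisance S T)"
    and inv: "invertible_mat (test_cov T (central_model S) K)"
  shows "central_alarm_prob M S w v T K \<tau> a
    = Q \<tau> (dof T (central_model S) K) (noncentrality T (central_model S) K (central_attack S T a))"
proof -
  define l where "l = subsystems S"
  have l: "set l = {1..nsub S}" "distinct l" by (auto simp: l_def)
  let ?D = "central_model S"
  let ?n = "\<Sum>i\<leftarrow>l. sdim S i" and ?q = "\<Sum>i\<leftarrow>l. odim S i" and ?m = "\<Sum>i\<leftarrow>l. adim S i"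
  define W where "W \<omega> = stack_vecs (map (\<lambda>k. stack_vecs (map (\<lambda>i. w i k \<omega>) l)) [0..<T])" for \<omega>
  define V where "V \<omega> = stack_vecs (map (\<lambda>k. stack_vecs (map (\<lambda>i. v i k \<omega>) l)) [1..<T+1])" for \<omega>
  note gn = gaussian_noiseD[OF noise]
  have c: "w j k \<omega> \<in> carrier_vec (sdim S j)" "v j k \<omega> \<in> carrier_vec (odim S j)"
    if "j \<in> {1..nsub S}" "\<omega> \<in> space M" for j k \<omega>
    using measurable_space[OF gn(1) that(2)] measurable_space[OF gn(2) that(2)] that(1) by simp_all
  have wf: "Amat S i j \<in> carrier_mat (sdim S i) (sdim S j)" "Cmat S i \<in> carrier_mat (odim S i) (sdim S i)"
    "Bamat S i \<in> carrier_mat (sdim S i) (adim S i)" if "i \<in> set l" "j \<in> set l" for i j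
    using S that l(1) by (auto simp: well_formed_def)
  have D: "dynm ?D \<in> carrier_mat ?n ?n" "attm ?D \<in> carrier_mat ?n ?m" "outm ?D \<in> carrier_mat ?q ?n"
    "pcov ?D \<in> carrier_mat ?n ?n" "(pcov ?D)\<^sup>T = pcov ?D" "mcov ?D \<in> carrier_mat ?q ?q" "(mcov ?D)\<^sup>T = mcov ?D"
    unfolding central_model_def detector_model.simps l_def[symmetric]
  proof -
    show "block_mat (sdim S) (sdim S) l l (Amat S) \<in> carrier_mat ?n ?n"
      "diag_block_mat (map (Bamat S) l) \<in> carrier_mat ?n ?m" "diag_block_mat (map (Cmat S) l) \<in> carrier_mat ?q ?n"
      using wf by (auto intro!: block_mat_carrier diag_block_mat_carrier)
    show "diag_block_mat (map (covw S) l) \<in> carrier_mat ?n ?n" "diag_block_mat (map (covv S) l) \<in> carrier_mat ?q ?q"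
      using gn(3,5) l(1) by (auto intro!: diag_block_mat_carrier)
    show "(diag_block_mat (map (covw S) l))\<^sup>T = diag_block_mat (map (covw S) l)"
      using gn(3,4) l(1) by (intro diag_block_mat_symmetric[where n = "sdim S"]) auto
    show "(diag_block_mat (map (covv S) l))\<^sup>T = diag_block_mat (map (covv S) l)"
      using gn(5,6) l(1) by (intro diag_block_mat_symmetric[where n = "odim S"]) auto
  qed
  have dim: "dim_row (central_nuisance S T) = T * ?q"
    using obs_mat_carrier[OF D(1,3), of T] by (simp add: central_nuisance_def)
  have "stack_vecs (map (\<lambda>i. a i k) l) \<in> carrier_vec ?m" for k
    using a l by (intro stack_vecs_carrier) (auto simp: admissible_attack_def)
  then have U: "central_attack S T a \<in> carrier_vec (T * ?m)"
    unfolding central_attack_def l_def[symmetric]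
    using stack_vecs_carrier[of "[0..<T]" "\<lambda>k. stack_vecs (map (\<lambda>i. a i k) l)" "\<lambda>_. ?m"] by (simp add: sum_list_triv)
  have Wk: "(\<lambda>\<omega>. stack_vecs (map (\<lambda>i. w i k \<omega>) l)) \<in> measurable M (vec_borel ?n)"
    and Vk: "(\<lambda>\<omega>. stack_vecs (map (\<lambda>i. v i k \<omega>) l)) \<in> measurable M (vec_borel ?q)" for k
    using gn(1,2) l(1) by (auto intro!: measurable_stack_vecs)
  have W: "W \<in> measurable M (vec_borel (T * ?n))"
    using measurable_stack_vecs[of "[0..<T]" "\<lambda>k \<omega>. stack_vecs (map (\<lambda>i. w i k \<omega>) l)" M "\<lambda>_. ?n"] Wk
    by (simp add: W_def[abs_def] sum_list_triv)
  have V: "V \<in> measurable M (vec_borel (T * ?q))"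
    using measurable_stack_vecs[of "[1..<T+1]" "\<lambda>k \<omega>. stack_vecs (map (\<lambda>i. v i k \<omega>) l)" M "\<lambda>_. ?q"] Vk
    by (simp add: V_def[abs_def] sum_list_triv)
  have "\<P>(\<omega> in M. test_statistic T ?D K (central_meas S T a (\<lambda>j k. w j k \<omega>) (\<lambda>j k. v j k \<omega>)) \<ge> \<tau>)
      = Q \<tau> (dof T ?D K) (noncentrality T ?D K (central_attack S T a))"
  proof (rule alarm_prob[OF D K dim ne inv U W V])
    have "pcov ?D = diag_block_mat (map (covw S) l)" "mcov ?D = diag_block_mat (map (covv S) l)"
      by (simp_all add: central_model_def l_def)
    then show "(\<integral>\<omega>. iexp (x \<bullet> W \<omega> + y \<bullet> V \<omega>) \<partial>M)
        = complex_of_real (exp (- (x \<bullet> (kronecker (1\<^sub>m T) (pcov ?D) *\<^sub>v x) + y \<bullet> (kronecker (1\<^sub>m T) (mcov ?D) *\<^sub>v y)) / 2))"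
      if "x \<in> carrier_vec (T * ?n)" "y \<in> carrier_vec (T * ?q)" for x y
      using stacked_noise_char[OF noise l(2) _ that] l(1) by (simp only: W_def V_def)
    show "K *\<^sub>v central_meas S T a (\<lambda>j k. w j k \<omega>) (\<lambda>j k. v j k \<omega>)
        = K *\<^sub>v (attack_response T ?D *\<^sub>v central_attack S T a + (noise_response T ?D *\<^sub>v W \<omega> + V \<omega>))"
      if "\<omega> \<in> space M" for \<omega>
      unfolding W_def V_def l_def by (rule central_meas_residual[OF S a _ _ K]) (use c that in auto)
  qed
  then show ?thesis by (simp add: central_alarm_prob_def)
qed

theorem mainTheorem2:
  fixes M :: "'w measure"
    and S :: interconnected_system
    and w v :: "nat \<Rightarrow> nat \<Rightarrow> 'w \<Rightarrow> real vec"
    and T :: nat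
    and ua :: signal
    and Nl :: "nat \<Rightarrow> real mat" and Nc :: "real mat"
    and \<tau>l :: "nat \<Rightarrow> real" and \<tau>c :: real
  assumes "prob_space M"
    and "well_formed S"
    and "gaussian_noise M S w v"
    and "admissible_attack S ua"
    and "0 < T"
    and "\<forall>i\<in>{1..nsub S}. left_null_space (local_nuisance S T i) \<noteq> {0\<^sub>v (T * odim S i)}"
    and "\<forall>i\<in>{1..nsub S}. rows_basis_left_null (Nl i) (local_nuisance S T i)"
    and "\<forall>i\<in>{1..nsub S}. invertible_mat (test_cov T (local_model S i) (Nl i))"
    and "\<forall>i\<in>{1..nsub S}. 0 \<le> \<tau>l i"
    and "left_null_space (central_nuisance S T) \<noteq> {0\<^sub>v (dim_row (central_nuisance S T))}"
    and "rows_basis_left_null Nc (central_nuisance S T)"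
    and "invertible_mat (test_cov T (central_model S) Nc)"
    and "0 \<le> \<tau>c"
  shows
    "(\<forall>i\<in>{1..nsub S}.
        local_alarm_prob M S w v T i (Nl i) (\<tau>l i) (no_attack S)
          = Q (\<tau>l i) (dof T (local_model S i) (Nl i)) 0 \<and>
        (test_mean T (local_model S i) (Nl i) (local_attack T i ua) \<noteq> 0\<^sub>v (dim_row (Nl i)) \<longrightarrow>
          local_alarm_prob M S w v T i (Nl i) (\<tau>l i) ua
            = Q (\<tau>l i) (dof T (local_model S i) (Nl i))
                (noncentrality T (local_model S i) (Nl i) (local_attack T i ua)))) \<and>
     central_alarm_prob M S w v T Nc \<tau>c (no_attack S)
       = Q \<tau>c (dof T (central_model S) Nc) 0 \<and>
     (test_mean T (central_model S) Nc (central_attack S T ua) \<noteq> 0\<^sub>v (dim_row Nc) \<longrightarrow>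
       central_alarm_prob M S w v T Nc \<tau>c ua
         = Q \<tau>c (dof T (central_model S) Nc)
             (noncentrality T (central_model S) Nc (central_attack S T ua)))"
proof -
  interpret prob_space M by fact
  have zero: "admissible_attack S (no_attack S)" by (simp add: admissible_attack_def no_attack_def)
  have local0: "local_attack T i (no_attack S) = 0\<^sub>v (\<Sum>k\<leftarrow>[0..<T]. adim S i)" for i
    unfolding local_attack_def no_attack_def by (rule stack_vecs_zero)
  have central0: "central_attack S T (no_attack S) = 0\<^sub>v (\<Sum>k\<leftarrow>[0..<T]. \<Sum>i\<leftarrow>subsystems S. adim S i)"
    unfolding central_attack_def no_attack_def stack_vecs_zero ..
  have loc: "local_alarm_prob M S w v T i (Nl i) (\<tau>l i) a
      = Q (\<tau>l i) (dof T (local_model S i) (Nl i)) (noncentrality T (local_model S i) (Nl i) (local_attack T i a))"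
    if "i \<in> {1..nsub S}" "admissible_attack S a" for i a
    using assms that by (intro local_alarm_prob_eq) auto
  have cen: "central_alarm_prob M S w v T Nc \<tau>c a
      = Q \<tau>c (dof T (central_model S) Nc) (noncentrality T (central_model S) Nc (central_attack S T a))"
    if "admissible_attack S a" for a
    using assms that by (intro central_alarm_prob_eq) auto
  show ?thesis
    using loc[OF _ zero] loc[OF _ assms(4)] cen[OF zero] cen[OF assms(4)]
    by (simp add: local0 central0 noncentrality_zero)
qed

end
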